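(* There is an unbounded function $f \in \mathcal{B}_{\mathbb{D}}$ (the Eremenko-Lyubich class for the disc) which is bounded on a spiral $\Gamma \subset \mathbb{D}$ that accumulates on the whole of $\partial \mathbb{D}$.
   Context: $\mathbb{D}=\{z\in\mathbb{C}:|z|<1\}$. A boundary path is a path $\Gamma:[0,1)\to\mathbb{D}$ with $|\Gamma(t)|\to 1$ as $t\to 1$. A holomorphic function $f$ in $\mathbb{D}$ has asymptotic value $a\in\mathbb{C}\cup\{\infty\}$ if there is a boundary path $\Gamma$ with $f(\Gamma(t))\to a$ as $t\to1$. $CV(f)=\{f(z): z\in\mathbb{D},\ f'(z)=0\}$, and $AV(f)$ is the set of finite asymptotic values of $f$. The class $\mathcal{B}_{\mathbb{D}}$ is the set of functions $f$ holomorphic and non-constant in $\mathbb{D}$ such that $CV(f)\cup AV(f)$ is bounded. A spiral in $\mathbb{D}$ accumulating on the whole of $\partial\mathbb{D}$ is a boundary path $\Gamma$ along which a continuous branch of the argument (defined for $t$ near $1$) tends to $+\infty$ or to $-\infty$ as $t\to 1$, so that $\overline{\Gamma}\cap\partial\mathbb{D}=\partial\mathbb{D}$; for example, $\{re^{i\theta}: r\in[0,1),\ \theta=(1-r)^{-1}\}$. *)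

theory Defs
  imports "HOL-Complex_Analysis.Complex_Analysis"
begin

abbreviation unit_disc :: "complex set" where
  "unit_disc \<equiv> ball 0 1"

definition boundary_path :: "(real \<Rightarrow> complex) \<Rightarrow> bool" where
  "boundary_path \<Gamma> \<longleftrightarrow>
     continuous_on {0..<1} \<Gamma> \<and> \<Gamma> ` {0..<1} \<subseteq> unit_disc \<and>
     ((\<lambda>t. norm (\<Gamma> t)) \<longlongrightarrow> 1) (at_left 1)"

definition critical_values :: "(complex \<Rightarrow> complex) \<Rightarrow> complex set" where
  "critical_values f = {f z | z. z \<in> unit_disc \<and> deriv f z = 0}"

text \<open>Only finite asymptotic values are collected; the value infinity is excluded by the type.\<close>

definition asymptotic_values :: "(complex \<Rightarrow> complex) \<Rightarrow> complex set" where
  "asymptotic_values f =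
     {a. \<exists>\<Gamma>. boundary_path \<Gamma> \<and> ((\<lambda>t. f (\<Gamma> t)) \<longlongrightarrow> a) (at_left 1)}"

definition EL_class_disc :: "(complex \<Rightarrow> complex) set" where
  "EL_class_disc =
     {f. f holomorphic_on unit_disc \<and> \<not> f constant_on unit_disc \<and>
         bounded (critical_values f \<union> asymptotic_values f)}"

text \<open>
  The function \<open>\<theta>\<close> is a continuous branch of the argument along the tail \<open>\<Gamma> ` {s..<1}\<close>,
  on which \<open>\<Gamma>\<close> must not vanish.
\<close>

definition boundary_spiral :: "(real \<Rightarrow> complex) \<Rightarrow> bool" where
  "boundary_spiral \<Gamma> \<longleftrightarrow> boundary_path \<Gamma> \<and>
     (\<exists>s\<in>{0..<1}. \<exists>\<theta> :: real \<Rightarrow> real.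
        continuous_on {s..<1} \<theta> \<and>
        (\<forall>t\<in>{s..<1}. \<Gamma> t \<noteq> 0 \<and> \<Gamma> t = of_real (norm (\<Gamma> t)) * cis (\<theta> t)) \<and>
        (filterlim \<theta> at_top (at_left 1) \<or> filterlim \<theta> at_bot (at_left 1)))"

end

theory Submission
  imports Defs
begin

text \<open>
  The map \<open>s \<mapsto> exp (- \<i> * Ln s)\<close> wraps a horizontal half-strip below the real axis into a strip that
  spirals out to the unit circle.  As in the construction of entire functions with a prescribed
  tract, one takes the Cauchy integral of \<open>exp (exp s)\<close> over the boundary of the half-strip, on which
  \<open>exp (exp s)\<close> is tiny.  It equals \<open>exp (exp s) + O(1)\<close> inside the spiralling strip and \<open>O(1)\<close>
  outside.  Instead of the boundary we integrate over the cross-cuts \<open>Re s = n\<close> and let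
  \<open>n\<close> tend to infinity: by Cauchy's theorem the limit is the same, and its holomorphy is immediate
  because the cross-cuts leave every compact subset of the disc.

  Inside the strip the derivative of \<open>exp (exp s)\<close> dominates the derivative of the error term when the
  function is large, which bounds the critical values.  A path with a large finite asymptotic value
  would stay in the strip and keep \<open>exp (exp s)\<close> in a disc omitting the origin; then \<open>exp s\<close>, hence
  \<open>s\<close>, would be bounded and the path could not tend to the circle.
\<close>

subsection \<open>The spiralling strip\<close>

definition spiral_map :: "complex \<Rightarrow> complex" where
  "spiral_map s = exp (- \<i> * Ln s)"

text \<open>The centre line of the strip is \<open>Im s = - 2 * pi\<close>: the strip has to lie below the real axis,
  where \<open>spiral_map\<close> takes values in the disc, and \<open>exp\<close> has period \<open>2 * pi * \<i>\<close>.\<close>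

definition strip :: "complex set" where
  "strip = {s. 0 < Re s \<and> -12 < Im s \<and> Im s < -3/2}"

lemma strip_nonpos: "s \<in> strip \<Longrightarrow> s \<notin> \<real>\<^sub>\<le>\<^sub>0"
  by (auto simp: strip_def complex_nonpos_Reals_iff)

lemma open_strip: "open strip"
proof -
  have *: "strip = {s. Re s > 0} \<inter> {s. Im s > -12} \<inter> {s. Im s < -3/2}"
    by (auto simp: strip_def)
  show ?thesis unfolding *
    by (auto intro!: open_Int open_halfspace_Re_gt open_halfspace_Im_gt open_halfspace_Im_lt)
qed

lemma convex_strip: "convex strip"
proof -
  have *: "strip = {s. Re s > 0} \<inter> {s. Im s > -12} \<inter> {s. Im s < -3/2}"
    by (auto simp: strip_def)
  show ?thesis unfolding *
    by (auto intro!: convex_Int convex_halfspace_Re_gt convex_halfspace_Im_gt convex_halfspace_Im_lt)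
qed

lemma spiral_map_nonzero [simp]: "spiral_map s \<noteq> 0"
  by (simp add: spiral_map_def)

lemma norm_spiral_map: "norm (spiral_map s) = exp (Im (Ln s))"
  by (simp add: spiral_map_def)

lemma Im_Ln_strip:
  assumes "s \<in> strip"
  shows "Im (Ln s) < 0"
proof -
  have "s \<noteq> 0" "0 < Re s" "Im s < 0" using assms by (auto simp: strip_def)
  then show ?thesis
    using Im_Ln_pos_le[of s] Im_Ln_le_pi[of s] by auto
qed

lemma spiral_map_in_disc: "s \<in> strip \<Longrightarrow> norm (spiral_map s) < 1"
  using Im_Ln_strip by (simp add: norm_spiral_map)

lemma holomorphic_spiral_map: "spiral_map holomorphic_on strip"
  unfolding spiral_map_def using strip_nonpos by (auto intro!: holomorphic_intros)

lemma continuous_on_spiral_map: "continuous_on strip spiral_map"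
  by (simp add: holomorphic_on_imp_continuous_on holomorphic_spiral_map)

lemma exp_2pi_gt_8: "exp (2 * pi) > 8"
proof -
  have "exp pi > 3" using exp_ge_add_one_self[of pi] pi_gt3 by linarith
  then have "exp pi * exp pi > 3 * 3" by (intro mult_strict_mono) auto
  then show ?thesis by (simp flip: exp_add)
qed

text \<open>Consecutive turns of the spiralling strip correspond to the strips scaled by
  \<open>exp (2 * pi)\<close>, which are disjoint because the ratio of the bounds of \<open>Im\<close> is only 8.\<close>

lemma inj_spiral_map: "inj_on spiral_map strip"
proof (rule inj_onI)
  \<comment> \<open>Points with equal images differ by a factor \<open>exp (2 * pi * n)\<close>. For
    positive \<open>n\<close> it exceeds 8 and would push the imaginary part below 8 * (-3/2) = -12;
    using this in both directions leaves \<open>n = 0\<close>.\<close>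
  have aux: "n \<le> 0" if "s \<in> strip" "t \<in> strip" "s = t * of_real (exp (2 * pi * of_int n))" for s t and n :: int
  proof (rule ccontr)
    assume "\<not> n \<le> 0"
    then have "exp (2 * pi) \<le> exp (2 * pi * of_int n)" by simp
    with exp_2pi_gt_8 have e: "exp (2 * pi * of_int n) > 8" by linarith
    have "Im s = Im t * exp (2 * pi * of_int n)"
      using that(3) by simp
    also have "\<dots> < Im t * 8"
      using e that by (auto simp: strip_def)
    finally show False using that by (simp add: strip_def)
  qed
  fix s t assume st: "s \<in> strip" "t \<in> strip" and eq: "spiral_map s = spiral_map t"
  obtain n where n: "- \<i> * Ln s = - \<i> * Ln t + (of_int (2 * n) * pi) * \<i>"
    using eq unfolding spiral_map_def exp_eq by blast
  have Ln: "Ln s = Ln t - of_real (2 * pi * of_int n)"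
    using arg_cong[OF n, of "\<lambda>w. \<i> * w"] by (simp add: algebra_simps)
  have nz: "s \<noteq> 0" "t \<noteq> 0" using st by (auto simp: strip_def)
  have "s = exp (Ln t - of_real (2 * pi * of_int n))" using nz Ln by (metis exp_Ln)
  then have 1: "s = t * of_real (exp (2 * pi * of_int (-n)))"
    using exp_Ln[OF nz(2)]
    by (simp only: diff_conv_add_uminus exp_add of_real_minus[symmetric] exp_of_real of_int_minus mult_minus_right)
  have "t = exp (Ln s + of_real (2 * pi * of_int n))" using nz Ln by (metis exp_Ln diff_add_cancel)
  then have 2: "t = s * of_real (exp (2 * pi * of_int n))"
    using exp_Ln[OF nz(1)] by (simp only: exp_add exp_of_real)
  have "n = 0" using aux[OF st 1] aux[OF st(2,1) 2] by simp
  then show "s = t" using 1 by simp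
qed

text \<open>With \<open>zeta = spiral_map s\<close> this is \<open>(zeta - z) / zeta\<close>, the
  part of the Cauchy kernel that vanishes at the pole.\<close>

definition kern_den :: "complex \<Rightarrow> complex \<Rightarrow> complex" where
  "kern_den z s = 1 - z * exp (\<i> * Ln s)"

lemma kern_den_eq: "kern_den z s = 1 - z / spiral_map s"
  by (simp add: kern_den_def spiral_map_def exp_minus field_simps)

lemma kern_den_eq_0_iff: "kern_den z s = 0 \<longleftrightarrow> z = spiral_map s"
  by (auto simp: kern_den_eq field_simps)

lemma norm_exp_diff_1_le:
  fixes x :: complex
  assumes "norm x \<le> 1/2"
  shows "norm (exp x - 1) \<le> 2 * norm x"
proof -
  have "norm (exp x - exp 0) \<le> 2 * norm (x - 0)"
  proof (rule field_differentiable_bound[where S = "cball 0 (1/2)"])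
    fix w :: complex assume "w \<in> cball 0 (1/2)"
    then have "norm w \<le> 1/2" by simp
    then show "norm (exp w) \<le> 2" using exp_bound_lemma[of w] by linarith
  qed (use assms in \<open>auto intro!: derivative_eq_intros\<close>)
  then show ?thesis by simp
qed

text \<open>A point at which the denominator of the kernel is small lies in the image of a small disc:
  if \<open>q = z / spiral_map s\<close> is close to 1, then \<open>z = spiral_map (s * exp (\<i> * Ln q))\<close>.\<close>

lemma kern_den_lower_bound:
  assumes "1 \<le> Re s" "Im s \<le> -2" "z \<notin> spiral_map ` ball s (1/2)"
  shows "norm (kern_den z s) \<ge> 1 / (8 * norm s)"
proof (rule ccontr)
  define q where "q = z / spiral_map s"
  assume "\<not> ?thesis"
  then have small: "norm (1 - q) < 1 / (8 * norm s)"
    by (simp add: kern_den_eq q_def)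
  have s1: "norm s \<ge> 1" using abs_Re_le_cmod[of s] assms(1) by linarith
  then have s0: "s \<noteq> 0" by auto
  have "1 / (8 * norm s) \<le> 1 / (8 * 1)" using s1 by (intro divide_left_mono) auto
  then have q8: "norm (q - 1) < 1/8" using small by (simp add: norm_minus_commute)
  then have q0: "q \<noteq> 0" by auto
  have L: "norm (Ln q) \<le> 2 * norm (q - 1)"
    using norm_Ln_le[of "q - 1"] q8 by simp
  define t where "t = s * exp (\<i> * Ln q)"
  have "norm (t - s) = norm s * norm (exp (\<i> * Ln q) - 1)"
    by (simp add: t_def flip: norm_mult) (simp add: algebra_simps)
  also have "\<dots> \<le> norm s * (2 * norm (Ln q))"
    using norm_exp_diff_1_le[of "\<i> * Ln q"] L q8 by (intro mult_left_mono) (auto simp: norm_mult)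
  also have "\<dots> \<le> norm s * (4 * norm (q - 1))"
    using L by (intro mult_left_mono) auto
  \<comment> \<open>The factor 4 times the assumed \<open>1 / (8 * norm s)\<close> gives exactly the
    radius 1/2; this fixes the constant 8.\<close>
  also have "\<dots> < 1/2"
    using small s0 by (simp add: field_simps norm_minus_commute)
  finally have "t \<in> ball s (1/2)" by (simp add: dist_norm norm_minus_commute)
  \<comment> \<open>No jump of the principal branch occurs: \<open>Im (Ln s)\<close> is below pi/2
    in modulus and the correction is at most 1/4.\<close>
  moreover have "Ln t = Ln s + \<i> * Ln q"
  proof -
    have "Ln (exp (Ln s + \<i> * Ln q)) = Ln s + \<i> * Ln q"
    proof (rule Ln_exp)
      have "\<bar>Re (Ln q)\<bar> \<le> 1/4" using abs_Re_le_cmod[of "Ln q"] L q8 by linarith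
      moreover have "\<bar>Im (Ln s)\<bar> < pi/2" using Re_Ln_pos_lt[OF s0] assms(1) by simp
      ultimately show "- pi < Im (Ln s + \<i> * Ln q)" "Im (Ln s + \<i> * Ln q) \<le> pi"
        using pi_gt3 by auto
    qed
    then show ?thesis using s0 by (simp add: exp_add t_def)
  qed
  then have "spiral_map t = spiral_map s * q"
    using q0 by (simp add: spiral_map_def ring_distribs exp_add exp_diff exp_minus field_simps flip: mult.assoc)
  then have "spiral_map t = z" by (simp add: q_def)
  ultimately show False using assms(3) by blast
qed

subsection \<open>The Cauchy kernel and its integrals\<close>

definition dexp :: "complex \<Rightarrow> complex" where
  "dexp s = exp (exp s)"

text \<open>Under \<open>zeta = spiral_map s\<close> the form \<open>d zeta / (zeta - z)\<close>
  becomes \<open>(- i / s) / kern_den z s\<close> times \<open>ds\<close>. Hence this is the Cauchy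
  kernel in the strip coordinate with density \<open>exp (exp s)\<close>.\<close>

definition kern :: "complex \<Rightarrow> complex \<Rightarrow> complex" where
  "kern z s = dexp s * (- \<i> / s) / kern_den z s"

text \<open>The half-width \<open>c\<close> about the centre line is a parameter because the values
  pi and 4 pi / 3 are both used later.\<close>

definition crosscut_integral :: "real \<Rightarrow> nat \<Rightarrow> complex \<Rightarrow> complex" where
  "crosscut_integral c n z =
     contour_integral (linepath (Complex n (- 2 * pi - c)) (Complex n (- 2 * pi + c))) (kern z)
       / (2 * pi * \<i>)"

lemma norm_dexp: "norm (dexp s) = exp (exp (Re s) * cos (Im s))"
  by (simp add: dexp_def Re_exp)

text \<open>The factor \<open>1 / s\<close> in the kernel cancels the growth of
  \<open>1 / kern_den\<close>, so the constant is uniform along the strip.\<close>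

lemma kern_bound:
  assumes "1 \<le> Re s" "Im s \<le> -2" "z \<notin> spiral_map ` ball s (1/2)"
  shows "norm (kern z s) \<le> 8 * norm (dexp s)"
proof -
  have "s \<noteq> 0" using assms by auto
  then have pos: "norm s > 0" by simp
  have d: "norm (kern_den z s) \<ge> 1 / (8 * norm s)" by (rule kern_den_lower_bound[OF assms])
  moreover have "0 < 1 / (8 * norm s)" using pos by simp
  ultimately have "norm (kern_den z s) > 0" by linarith
  then have "norm (dexp s) * (1 / norm s) / norm (kern_den z s) \<le> norm (dexp s) * (1 / norm s) / (1 / (8 * norm s))"
    using pos d by (intro divide_left_mono) auto
  also have "\<dots> = 8 * norm (dexp s)" using pos by (simp add: field_simps)
  finally show ?thesis by (simp add: kern_def norm_mult norm_divide)
qed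

lemma holomorphic_kern_den: "kern_den z holomorphic_on strip"
  unfolding kern_den_def using strip_nonpos by (auto intro!: holomorphic_intros)

lemma holomorphic_kern: "kern z holomorphic_on strip - {s. spiral_map s = z}"
proof -
  have "s \<noteq> 0" if "s \<in> strip" for s using that by (auto simp: strip_def)
  moreover have "kern_den z s \<noteq> 0" if "spiral_map s \<noteq> z" for s
    using that by (auto simp: kern_den_eq_0_iff)
  moreover have "kern_den z holomorphic_on strip - {s. spiral_map s = z}"
    using holomorphic_kern_den holomorphic_on_subset by blast
  ultimately show ?thesis
    unfolding kern_def dexp_def by (auto intro!: holomorphic_intros)
qed

text \<open>At its zero the denominator has derivative \<open>- i / s\<close>, the same factor as in
  the numerator, so only the density remains.\<close>

lemma residue_kern:
  assumes "s \<in> strip"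
  shows "residue (kern (spiral_map s)) s = dexp s"
proof -
  have s0: "s \<noteq> 0" using assms by (auto simp: strip_def)
  have nz: "t \<noteq> 0" if "t \<in> strip" for t using that by (auto simp: strip_def)
  have "residue (\<lambda>t. dexp t * (- \<i> / t) / kern_den (spiral_map s) t) s =
          dexp s * (- \<i> / s) / (- \<i> / s)"
  proof (rule residue_simple_pole_deriv)
    show "open strip" "connected strip" "s \<in> strip"
      using open_strip convex_strip convex_connected assms by blast+
    show "kern_den (spiral_map s) holomorphic_on strip" by (rule holomorphic_kern_den)
    show "(\<lambda>t. dexp t * (- \<i> / t)) holomorphic_on strip"
      unfolding dexp_def using nz by (auto intro!: holomorphic_intros)
    have "((\<lambda>t. 1 - spiral_map s * exp (\<i> * Ln t)) has_field_derivative
           0 - spiral_map s * (exp (\<i> * Ln s) * (\<i> * (1 / s)))) (at s)"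
      using strip_nonpos[OF assms] by (auto intro!: derivative_eq_intros simp: field_simps)
    also have "0 - spiral_map s * (exp (\<i> * Ln s) * (\<i> * (1 / s))) = - \<i> / s"
      by (simp add: spiral_map_def exp_minus)
    finally show "(kern_den (spiral_map s) has_field_derivative - \<i> / s) (at s)"
      unfolding kern_den_def .
  qed (use s0 in \<open>auto simp: dexp_def kern_den_eq_0_iff\<close>)
  also have "(\<lambda>t. dexp t * (- \<i> / t) / kern_den (spiral_map s) t) = kern (spiral_map s)"
    by (simp add: kern_def fun_eq_iff)
  also have "dexp s * (- \<i> / s) / (- \<i> / s) = dexp s"
    using s0 by (intro nonzero_mult_div_cancel_right) simp
  finally show ?thesis .
qed

lemma strip_rectangle:
  assumes "\<bar>c\<bar> \<le> 4 * pi / 3" "0 < x"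
  shows "cbox (Complex x (- 2 * pi - c)) (Complex y (- 2 * pi + c)) \<subseteq> strip"
proof
  have "3 * pi \<ge> 9" "pi < 3.2" using pi_gt3 pi_less_4 pi_approx by auto
  then show "s \<in> strip" if "s \<in> cbox (Complex x (- 2 * pi - c)) (Complex y (- 2 * pi + c))" for s
    using that assms by (auto simp: in_cbox_complex_iff strip_def)
qed

text \<open>By injectivity of \<open>spiral_map\<close> the kernel has at most one pole in the
  strip. The sum has one term or none, which treats \<open>z\<close> inside and outside the image of
  the rectangle alike.\<close>

lemma contour_integral_rectpath_kern:
  assumes c: "0 < c" "c \<le> 4 * pi / 3" and xy: "0 < x" "x < y"
    and z: "z \<notin> spiral_map ` path_image (rectpath (Complex x (- 2 * pi - c)) (Complex y (- 2 * pi + c)))"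
  shows "contour_integral (rectpath (Complex x (- 2 * pi - c)) (Complex y (- 2 * pi + c))) (kern z) =
     2 * pi * \<i> * (\<Sum>s\<in>{s \<in> box (Complex x (- 2 * pi - c)) (Complex y (- 2 * pi + c)). spiral_map s = z}. dexp s)"
proof -
  define a b where "a = Complex x (- 2 * pi - c)" and "b = Complex y (- 2 * pi + c)"
  have ab: "Re a < Re b" "Im a < Im b" using c xy by (auto simp: a_def b_def)
  have sub: "cbox a b \<subseteq> strip" using strip_rectangle[of c x y] c xy by (auto simp: a_def b_def)
  have pim: "path_image (rectpath a b) = cbox a b - box a b"
    using ab by (intro path_image_rectpath_cbox_minus_box) auto
  define P where "P = {s \<in> strip. spiral_map s = z}"
  have Psub: "P \<subseteq> {s}" if "s \<in> P" for s
    using that inj_spiral_map by (auto simp: P_def inj_on_def)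
  then have fin: "finite P" by (metis finite.emptyI finite_insert finite_subset ex_in_conv)
  have "contour_integral (rectpath a b) (kern z) =
      2 * pi * \<i> * (\<Sum>p\<in>P. winding_number (rectpath a b) p * residue (kern z) p)"
  proof (rule Residue_theorem)
    show "open strip" "connected strip" "finite P"
      using open_strip convex_strip convex_connected fin by blast+
    show "kern z holomorphic_on strip - P"
      using holomorphic_kern by (rule holomorphic_on_subset) (auto simp: P_def)
    show "path_image (rectpath a b) \<subseteq> strip - P"
      using z sub pim unfolding P_def a_def[symmetric] b_def[symmetric] by auto
    show "\<forall>w. w \<notin> strip \<longrightarrow> winding_number (rectpath a b) w = 0"
      using sub ab by (auto intro!: winding_number_rectpath_outside)
  qed auto
  also have "(\<Sum>p\<in>P. winding_number (rectpath a b) p * residue (kern z) p) =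
             (\<Sum>p\<in>{s \<in> box a b. spiral_map s = z}. dexp p)"
  proof (rule sum.mono_neutral_cong_right)
    show "{s \<in> box a b. spiral_map s = z} \<subseteq> P"
      using sub box_subset_cbox[of a b] by (auto simp: P_def)
    show "\<forall>p\<in>P - {s \<in> box a b. spiral_map s = z}. winding_number (rectpath a b) p * residue (kern z) p = 0"
    proof
      fix p assume p: "p \<in> P - {s \<in> box a b. spiral_map s = z}"
      then have "p \<notin> cbox a b"
        using z pim unfolding P_def a_def[symmetric] b_def[symmetric] by auto
      then show "winding_number (rectpath a b) p * residue (kern z) p = 0"
        using ab by (simp add: winding_number_rectpath_outside)
    qed
    show "winding_number (rectpath a b) p * residue (kern z) p = dexp p"
      if "p \<in> {s \<in> box a b. spiral_map s = z}" for p
      using that residue_kern[of p] sub box_subset_cbox[of a b] winding_number_rectpath[of p a b] by auto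
  qed (rule fin)
  finally show ?thesis unfolding a_def b_def .
qed

section \<open>Decay of the density near the edges and the resulting contour estimates\<close>

lemma cos_le_minus_half:
  fixes y :: real
  assumes "2 * pi / 3 \<le> \<bar>y\<bar>" "\<bar>y\<bar> \<le> 4 * pi / 3"
  shows "cos y \<le> - 1 / 2"
proof -
  have "\<bar>\<bar>y\<bar> - pi\<bar> \<le> pi / 3" using assms unfolding abs_le_iff by auto
  then have "cos (pi / 3) \<le> cos \<bar>\<bar>y\<bar> - pi\<bar>"
    by (intro cos_monotone_0_pi_le) auto
  then show ?thesis by (simp add: cos_60 cos_diff)
qed

text \<open>The exponent is at most \<open>- exp x / 2\<close> with \<open>x = Re s\<close>, and
  \<open>exp x >= 2 * x\<close> weakens the doubly exponential decay to a bound that telescopes over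
  unit steps.\<close>

lemma norm_dexp_le:
  assumes "cos (Im s) \<le> - 1 / 2"
  shows "norm (dexp s) \<le> exp (- Re s)"
proof -
  have "exp (Re s) \<ge> 2 * Re s"
  proof (cases "Re s \<ge> 0")
    case True
    have "0 \<le> (Re s - 1)\<^sup>2" by simp
    with exp_lower_Taylor_quadratic[OF True] show ?thesis by (simp add: power2_eq_square algebra_simps)
  next
    case False
    then show ?thesis using exp_gt_zero[of "Re s"] by linarith
  qed
  moreover have "exp (Re s) * cos (Im s) \<le> exp (Re s) * (- 1 / 2)"
    using assms by (intro mult_left_mono) auto
  ultimately have "exp (Re s) * cos (Im s) \<le> - Re s" by simp
  then show ?thesis by (simp add: norm_dexp)
qed

lemma continuous_on_kern:
  assumes "X \<subseteq> strip" "z \<notin> spiral_map ` X"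
  shows "continuous_on X (kern z)"
  by (rule continuous_on_subset[OF holomorphic_on_imp_continuous_on[OF holomorphic_kern[of z]]])
     (use assms in auto)

text \<open>The hypothesis on \<open>z\<close> in \<open>kern_bound\<close>, imposed along a whole
  set of integration.\<close>

definition clear :: "complex set \<Rightarrow> complex \<Rightarrow> bool" where
  "clear X z \<longleftrightarrow> (\<forall>s\<in>X. z \<notin> spiral_map ` ball s (1/2))"

lemma clear_subset: "clear X z \<Longrightarrow> Y \<subseteq> X \<Longrightarrow> clear Y z"
  by (auto simp: clear_def)

lemma clear_not_image: "clear X z \<Longrightarrow> z \<notin> spiral_map ` X"
  by (force simp: clear_def)

lemma two_pi_bounds: "3 * pi > 9" "pi < 3.2"
  using pi_gt3 pi_approx by auto

lemma cos_minus_2pi: "cos (- (2 * pi) + x) = cos x" "cos (- (2 * pi) - x) = cos x" for x :: real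
  by (simp_all add: cos_add cos_diff)

lemma segment_bound:
  assumes "\<And>s. s \<in> closed_segment p q \<Longrightarrow>
             1 \<le> Re s \<and> Im s \<le> -2 \<and> -12 < Im s \<and> norm (dexp s) \<le> B"
    and "clear (closed_segment p q) z"
  shows "norm (contour_integral (linepath p q) (kern z)) \<le> 8 * B * norm (q - p)"
proof (rule contour_integral_bound_linepath)
  have "closed_segment p q \<subseteq> strip"
  proof
    fix s assume "s \<in> closed_segment p q"
    from assms(1)[OF this] show "s \<in> strip" by (auto simp: strip_def)
  qed
  then show "kern z contour_integrable_on linepath p q"
    using assms(2) by (intro contour_integrable_continuous_linepath continuous_on_kern clear_not_image) auto
  have "0 \<le> norm (dexp p)" by simp
  also have "\<dots> \<le> B" using assms(1)[of p] by simp
  finally show "0 \<le> 8 * B" by simp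
  show "norm (kern z s) \<le> 8 * B" if "s \<in> closed_segment p q" for s
    using kern_bound[of s z] assms that by (force simp: clear_def)
qed

lemma closed_segment_horizontal:
  "x \<le> x' \<Longrightarrow> closed_segment (Complex x y) (Complex x' y) = {s. Im s = y \<and> x \<le> Re s \<and> Re s \<le> x'}"
  by (subst closed_segment_same_Im) (auto simp: closed_segment_eq_real_ivl)

lemma closed_segment_vertical:
  "y \<le> y' \<Longrightarrow> closed_segment (Complex x y) (Complex x y') = {s. Re s = x \<and> y \<le> Im s \<and> Im s \<le> y'}"
  by (subst closed_segment_same_Re) (auto simp: closed_segment_eq_real_ivl)

text \<open>Unit segments are added one at a time. Each costs at most \<open>8 * exp (- n)\<close>
  for its left end \<open>n\<close>, and \<open>exp (- 1) <= 1/2\<close> turns this into a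
  telescoping difference, so the bound does not grow with the length.\<close>

lemma horizontal_bound:
  fixes m k :: nat
  assumes y: "y = - 2 * pi - c \<or> y = - 2 * pi + c" and c: "pi \<le> c" "c \<le> 4 * pi / 3" and m: "1 \<le> m"
    and "clear (closed_segment (Complex m y) (Complex (m + k) y)) z"
  shows "norm (contour_integral (linepath (Complex m y) (Complex (m + k) y)) (kern z))
           \<le> 16 * (exp (- real m) - exp (- real (m + k)))"
  using assms(5)
proof (induction k)
  case 0
  show ?case unfolding add_0_right contour_integral_trivial by simp
next
  case (Suc k)
  let ?p = "Complex m y" and ?q = "Complex (m + k) y" and ?r = "Complex (m + Suc k) y"
  have seg: "closed_segment ?p ?r = {s. Im s = y \<and> real m \<le> Re s \<and> Re s \<le> real (m + Suc k)}"
    "closed_segment ?q ?r = {s. Im s = y \<and> real (m + k) \<le> Re s \<and> Re s \<le> real (m + Suc k)}"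
    by (rule closed_segment_horizontal; simp)+
  have q: "?q \<in> closed_segment ?p ?r"
    unfolding seg by simp
  have sub: "closed_segment ?p ?q \<subseteq> closed_segment ?p ?r" "closed_segment ?q ?r \<subseteq> closed_segment ?p ?r"
    using q by (auto simp: subset_closed_segment)
  have yb: "-12 < y" "y \<le> -2"
    using y c two_pi_bounds by linarith+
  have "cos y = cos c" using y cos_minus_2pi[of c] by auto
  also have "\<dots> \<le> - 1 / 2" using c pi_gt_zero by (intro cos_le_minus_half) linarith+
  finally have cy: "cos y \<le> - 1 / 2" .
  have strip: "closed_segment ?p ?r \<subseteq> strip"
    unfolding seg using m yb by (auto simp: strip_def)
  have cont: "continuous_on (closed_segment ?p ?r) (kern z)"
    using strip Suc.prems by (intro continuous_on_kern clear_not_image) auto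
  have split: "contour_integral (linepath ?p ?r) (kern z) =
        contour_integral (linepath ?p ?q) (kern z) + contour_integral (linepath ?q ?r) (kern z)"
    by (rule contour_integral_split_linepath[OF cont q])
  have 1: "norm (contour_integral (linepath ?p ?q) (kern z)) \<le> 16 * (exp (- real m) - exp (- real (m + k)))"
    using Suc.IH clear_subset[OF Suc.prems sub(1)] by simp
  have "norm (contour_integral (linepath ?q ?r) (kern z)) \<le> 8 * exp (- real (m + k)) * norm (?r - ?q)"
  proof (rule segment_bound)
    fix s assume "s \<in> closed_segment ?q ?r"
    then have s: "Im s = y" "Re s \<ge> real (m + k)"
      unfolding seg by auto
    then have "norm (dexp s) \<le> exp (- Re s)" using cy by (intro norm_dexp_le) simp
    also have "\<dots> \<le> exp (- real (m + k))" using s by simp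
    finally show "1 \<le> Re s \<and> Im s \<le> -2 \<and> -12 < Im s \<and> norm (dexp s) \<le> exp (- real (m + k))"
      using s yb m by simp
  qed (use clear_subset[OF Suc.prems sub(2)] in simp)
  also have "?r - ?q = 1" by (simp add: complex_eq_iff)
  also have "8 * exp (- real (m + k)) * norm (1 :: complex) \<le> 16 * (exp (- real (m + k)) - exp (- real (m + Suc k)))"
  proof -
    have "exp (1::real) \<ge> 2" using exp_ge_add_one_self[of 1] by simp
    then have "exp (- 1 :: real) \<le> 1/2" by (simp add: exp_minus field_simps)
    then have "exp (- real (m + k)) * exp (-1) \<le> exp (- real (m + k)) * (1/2)"
      by (intro mult_left_mono) auto
    moreover have "exp (- real (m + Suc k)) = exp (- real (m + k)) * exp (-1)"
      by (simp flip: exp_add)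
    ultimately show ?thesis by simp
  qed
  finally have 2: "norm (contour_integral (linepath ?q ?r) (kern z))
      \<le> 16 * (exp (- real (m + k)) - exp (- real (m + Suc k)))" .
  have "norm (contour_integral (linepath ?p ?r) (kern z)) \<le>
     norm (contour_integral (linepath ?p ?q) (kern z)) + norm (contour_integral (linepath ?q ?r) (kern z))"
    unfolding split by (rule norm_triangle_ineq)
  also have "\<dots> \<le> 16 * (exp (- real m) - exp (- real (m + k))) + 16 * (exp (- real (m + k)) - exp (- real (m + Suc k)))"
    by (rule add_mono[OF 1 2])
  finally show ?case by (simp add: algebra_simps)
qed

text \<open>The residue theorem on the rectangle between the two cross-cuts: the vertical sides are
  the cross-cuts, the pole gives the sum, and the error comes from the horizontal sides
  alone.\<close>

lemma crosscut_integral_step: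
  fixes m n :: nat
  assumes c: "pi \<le> c" "c \<le> 4 * pi / 3" and mn: "1 \<le> m" "m < n"
    and clr: "clear (path_image (rectpath (Complex m (- 2 * pi - c)) (Complex n (- 2 * pi + c)))) z"
  shows "norm (crosscut_integral c n z - crosscut_integral c m z -
            (\<Sum>s\<in>{s \<in> box (Complex m (- 2 * pi - c)) (Complex n (- 2 * pi + c)). spiral_map s = z}. dexp s))
         \<le> 16 * exp (- real m)"
proof -
  define a b where "a = Complex m (- 2 * pi - c)" and "b = Complex n (- 2 * pi + c)"
  define a2 a4 where "a2 = Complex n (- 2 * pi - c)" and "a4 = Complex m (- 2 * pi + c)"
  define I where "I = (\<lambda>p q. contour_integral (linepath p q) (kern z))"
  define S where "S = (\<Sum>s\<in>{s \<in> box a b. spiral_map s = z}. dexp s)"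
  have c0: "c > 0" using c pi_gt_zero by linarith
  have ab: "Re a \<le> Re b" "Im a \<le> Im b" using c0 mn by (auto simp: a_def b_def)
  have rect: "rectpath a b = linepath a a2 +++ linepath a2 b +++ linepath b a4 +++ linepath a4 a"
    by (simp add: rectpath_def Let_def a_def b_def a2_def a4_def)
  have pim: "path_image (rectpath a b) = closed_segment a a2 \<union> closed_segment a2 b \<union> closed_segment b a4 \<union> closed_segment a4 a"
    by (simp add: rect path_image_join Un_assoc)
  have clr': "clear (path_image (rectpath a b)) z" using clr unfolding a_def b_def .
  have "path_image (rectpath a b) \<subseteq> strip"
    using path_image_rectpath_subset_cbox[OF ab] strip_rectangle[of c "real m" "real n"] c c0 mn
    by (auto simp: a_def b_def)
  then have "continuous_on (path_image (rectpath a b)) (kern z)"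
    using clr' by (intro continuous_on_kern clear_not_image)
  then have int: "kern z contour_integrable_on linepath a a2" "kern z contour_integrable_on linepath a2 b"
     "kern z contour_integrable_on linepath b a4" "kern z contour_integrable_on linepath a4 a"
    by (auto intro!: contour_integrable_continuous_linepath elim: continuous_on_subset simp: pim)
  have "contour_integral (rectpath a b) (kern z) = I a a2 + (I a2 b + (I b a4 + I a4 a))"
    unfolding rect I_def using int by simp
  moreover have "contour_integral (rectpath a b) (kern z) = 2 * pi * \<i> * S"
    unfolding S_def a_def b_def using c c0 mn clr
    by (intro contour_integral_rectpath_kern clear_not_image) auto
  moreover have rev: "I b a4 = - I a4 b" "I a4 a = - I a a4"
    unfolding I_def by (subst contour_integral_reversepath[symmetric]; simp)+
  ultimately have eq: "I a2 b - I a a4 - 2 * pi * \<i> * S = I a4 b - I a a2"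
    by (simp add: algebra_simps)
  have "clear (closed_segment a4 b) z" "clear (closed_segment a a2) z"
    using clr' pim by (auto simp: closed_segment_commute clear_def)
  then have "norm (I a4 b) \<le> 16 * exp (- real m)" "norm (I a a2) \<le> 16 * exp (- real m)"
    unfolding I_def a4_def b_def a_def a2_def using c mn
    using horizontal_bound[of "- 2 * pi + c" c m "n - m" z] horizontal_bound[of "- 2 * pi - c" c m "n - m" z]
    by (auto elim: order.trans)
  then have "norm (I a2 b - I a a4 - 2 * pi * \<i> * S) \<le> 16 * exp (- real m) + 16 * exp (- real m)"
    unfolding eq using norm_triangle_ineq4[of "I a4 b" "I a a2"] by linarith
  moreover have "crosscut_integral c n z - crosscut_integral c m z - S =
       (I a2 b - I a a4 - 2 * pi * \<i> * S) / (2 * pi * \<i>)"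
    by (simp add: crosscut_integral_def I_def a_def b_def a2_def a4_def field_simps)
  ultimately have "norm (crosscut_integral c n z - crosscut_integral c m z - S) \<le> 32 * exp (- real m) / (2 * pi)"
    using divide_right_mono[of "norm (I a2 b - I a a4 - 2 * pi * \<i> * S)" "32 * exp (- real m)" "2 * pi"]
    by (simp add: norm_divide norm_mult)
  also have "\<dots> \<le> 32 * exp (- real m) / 2"
    using pi_gt3 by (intro divide_left_mono) auto
  finally show ?thesis by (simp add: S_def a_def b_def)
qed

section \<open>The far end of the strip approaches the unit circle\<close>

text \<open>Dividing by \<open>Re s\<close> leaves the argument of
  \<open>1 + i * Im s / Re s\<close>, at most twice the modulus of that quotient, which is below
  \<open>12 / Re s\<close>; the threshold 24 keeps it under 1/2.\<close>

lemma Im_Ln_strip_ge: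
  assumes "s \<in> strip" "Re s > 24"
  shows "Im (Ln s) \<ge> - 24 / Re s"
proof -
  define w where "w = \<i> * of_real (Im s / Re s)"
  have nw: "norm w = \<bar>Im s\<bar> / Re s" using assms by (simp add: w_def norm_mult norm_divide)
  have le: "\<bar>Im s\<bar> / Re s \<le> 12 / Re s" using assms by (intro divide_right_mono) (auto simp: strip_def)
  also have "12 / Re s < 12 / 24" using assms by (intro divide_strict_left_mono) auto
  finally have "norm w < 1/2" using nw by simp
  then have L: "norm (Ln (1 + w)) \<le> 2 * norm w" by (rule norm_Ln_le)
  have "s = of_real (Re s) * (1 + w)"
    using assms by (auto simp: w_def complex_eq_iff)
  then have "Ln s = Ln (of_real (Re s) * (1 + w))" by (rule arg_cong)
  also have "\<dots> = of_real (ln (Re s)) + Ln (1 + w)"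
    using assms by (subst Ln_times_of_real) (auto simp: w_def complex_eq_iff Ln_of_real)
  finally have "Im (Ln s) = Im (Ln (1 + w))" by simp
  also have "\<dots> \<ge> - norm (Ln (1 + w))" using abs_Im_le_cmod[of "Ln (1 + w)"] by linarith
  finally show ?thesis using L le nw by simp
qed

lemma spiral_map_tendsto_boundary:
  assumes "r < 1"
  obtains N :: nat where "1 \<le> N" "\<And>s. s \<in> strip \<Longrightarrow> real N \<le> Re s \<Longrightarrow> r < norm (spiral_map s)"
proof -
  obtain N :: nat where N: "real N > max 24 (24 / (1 - r))" using reals_Archimedean2 by blast
  show ?thesis
  proof (rule that[of N])
    show "1 \<le> N" using N by linarith
    fix s assume s: "s \<in> strip" "real N \<le> Re s"
    have x: "Re s > 24" "Re s > 24 / (1 - r)" using N s by auto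
    have "r < 1 - 24 / Re s" using x assms by (simp add: field_simps)
    also have "\<dots> \<le> 1 + Im (Ln s)" using Im_Ln_strip_ge[OF s(1) x(1)] by simp
    also have "\<dots> \<le> exp (Im (Ln s))" by (rule exp_ge_add_one_self)
    finally show "r < norm (spiral_map s)" by (simp add: norm_spiral_map)
  qed
qed

lemma dist_half_bounds:
  assumes "t \<in> ball s (1/2)"
  shows "Re s - 1/2 < Re t" "Re t < Re s + 1/2" "Im s - 1/2 < Im t" "Im t < Im s + 1/2"
proof -
  have "\<bar>Re (s - t)\<bar> < 1/2" "\<bar>Im (s - t)\<bar> < 1/2"
    using assms abs_Re_le_cmod[of "s - t"] abs_Im_le_cmod[of "s - t"] by (auto simp: dist_norm)
  then show "Re s - 1/2 < Re t" "Re t < Re s + 1/2" "Im s - 1/2 < Im t" "Im t < Im s + 1/2"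
    by (simp_all only: abs_less_iff minus_complex.sel) linarith+
qed

text \<open>One extra unit in \<open>Suc N\<close> absorbs the discs of radius 1/2, whose images
  then lie outside the disc of radius \<open>r\<close>. That \<open>N\<close> serves all
  \<open>z\<close> of the smaller disc makes the later convergence locally uniform.\<close>

lemma clear_far:
  assumes "r < 1"
  obtains N :: nat where "2 \<le> N"
    "\<And>z. norm z \<le> r \<Longrightarrow> clear {s. real N \<le> Re s \<and> - 11 \<le> Im s \<and> Im s \<le> -2} z"
proof -
  obtain N :: nat where N: "1 \<le> N" "\<And>s. s \<in> strip \<Longrightarrow> real N \<le> Re s \<Longrightarrow> r < norm (spiral_map s)"
    using spiral_map_tendsto_boundary[OF assms] by blast
  show ?thesis
  proof (rule that[of "Suc N"])
    show "2 \<le> Suc N" using N by simp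
    fix z :: complex assume z: "norm z \<le> r"
    show "clear {s. real (Suc N) \<le> Re s \<and> - 11 \<le> Im s \<and> Im s \<le> -2} z"
      unfolding clear_def
    proof (safe, simp)
      fix s t assume s: "1 + real N \<le> Re s" "- 11 \<le> Im s" "Im s \<le> -2"
        and t: "dist s t * 2 < 1" and zt: "z = spiral_map t"
      have "t \<in> ball s (1/2)" using t by simp
      note dist_half_bounds[OF this]
      then have "t \<in> strip" "real N \<le> Re t" using s N(1) by (auto simp: strip_def)
      then show False using N(2)[of t] z zt by simp
    qed
  qed
qed

lemma crosscut_in_far_region:
  assumes "0 \<le> c" "c \<le> 4 * pi / 3" "N \<le> m" "m \<le> n"
  shows "cbox (Complex m (- 2 * pi - c)) (Complex n (- 2 * pi + c))
           \<subseteq> {s. real N \<le> Re s \<and> - 11 \<le> Im s \<and> Im s \<le> -2}"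
  using assms two_pi_bounds by (auto simp: in_cbox_complex_iff)

lemma rectpath_in_far_region:
  assumes "0 \<le> c" "c \<le> 4 * pi / 3" "N \<le> m" "m \<le> n"
  shows "path_image (rectpath (Complex m (- 2 * pi - c)) (Complex n (- 2 * pi + c)))
           \<subseteq> {s. real N \<le> Re s \<and> - 11 \<le> Im s \<and> Im s \<le> -2}"
  using path_image_rectpath_subset_cbox[of "Complex m (- 2 * pi - c)" "Complex n (- 2 * pi + c)"]
    crosscut_in_far_region[OF assms] assms by auto

text \<open>There is no preimage of \<open>z\<close> between far cross-cuts, so the residue term
  disappears and the integrals form a Cauchy sequence.\<close>

lemma crosscut_integral_far:
  fixes m n N :: nat
  assumes clr: "clear {s. real N \<le> Re s \<and> - 11 \<le> Im s \<and> Im s \<le> -2} z"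
    and "N \<le> m" "m \<le> n" "1 \<le> N"
  shows "norm (crosscut_integral pi n z - crosscut_integral pi m z) \<le> 16 * exp (- real m)"
proof (cases "m = n")
  case False
  have empty: "{s \<in> box (Complex m (- 2 * pi - pi)) (Complex n (- 2 * pi + pi)). spiral_map s = z} = {}"
    using clear_not_image[OF clear_subset[OF clr crosscut_in_far_region[of pi N m n]]] assms
      box_subset_cbox[of "Complex m (- 2 * pi - pi)" "Complex n (- 2 * pi + pi)"] by auto
  have "norm (crosscut_integral pi n z - crosscut_integral pi m z -
      (\<Sum>s\<in>{s \<in> box (Complex m (- 2 * pi - pi)) (Complex n (- 2 * pi + pi)). spiral_map s = z}. dexp s))
         \<le> 16 * exp (- real m)"
    using assms False by (intro crosscut_integral_step clear_subset[OF clr rectpath_in_far_region]) auto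
  then show ?thesis unfolding empty by simp
qed auto

subsection \<open>The limit function\<close>

lemma exp_minus_tendsto_0: "(\<lambda>n. C * exp (- real n)) \<longlonglongrightarrow> 0" for C :: real
proof -
  have "(\<lambda>n. C * exp (- 1) ^ n) \<longlonglongrightarrow> C * 0"
    by (intro tendsto_mult tendsto_const LIMSEQ_realpow_zero) auto
  then show ?thesis by (simp flip: exp_of_nat_mult)
qed

text \<open>The value of \<open>lim\<close> is meaningful inside the unit disc, where convergence is
  proved; there every half-width from pi to 4 pi / 3 yields the same limit.\<close>

definition tract_fun :: "complex \<Rightarrow> complex" where
  "tract_fun z = lim (\<lambda>n. crosscut_integral pi n z)"

lemma crosscut_integral_LIMSEQ:
  assumes "norm z < 1"
  shows "(\<lambda>n. crosscut_integral pi n z) \<longlonglongrightarrow> tract_fun z"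
proof -
  obtain N :: nat where N: "2 \<le> N"
    "\<And>w. norm w \<le> norm z \<Longrightarrow> clear {s. real N \<le> Re s \<and> - 11 \<le> Im s \<and> Im s \<le> -2} w"
    using clear_far[OF assms] by blast
  have "Cauchy (\<lambda>n. crosscut_integral pi n z)"
  proof (rule CauchyI')
    fix e :: real assume "e > 0"
    then have "eventually (\<lambda>n. 16 * exp (- real n) < e) sequentially"
      using order_tendstoD(2)[OF exp_minus_tendsto_0[of 16]] by blast
    then obtain M where M: "\<And>n. n \<ge> M \<Longrightarrow> 16 * exp (- real n) < e"
      by (auto simp: eventually_sequentially)
    show "\<exists>M. \<forall>m\<ge>M. \<forall>n>m. dist (crosscut_integral pi m z) (crosscut_integral pi n z) < e"
    proof (intro exI[of _ "max M N"] allI impI)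
      fix m n assume "max M N \<le> m" "m < n"
      then show "dist (crosscut_integral pi m z) (crosscut_integral pi n z) < e"
        using crosscut_integral_far[OF N(2), of z m n] N(1) M[of m] by (simp add: dist_norm norm_minus_commute)
    qed
  qed
  then show ?thesis
    unfolding tract_fun_def by (simp add: Cauchy_convergent_iff convergent_LIMSEQ_iff)
qed

lemma tract_fun_approx:
  assumes clr: "clear {s. real N \<le> Re s \<and> - 11 \<le> Im s \<and> Im s \<le> -2} z"
    and "norm z < 1" "N \<le> m" "1 \<le> N"
  shows "norm (tract_fun z - crosscut_integral pi m z) \<le> 16 * exp (- real m)"
proof (rule LIMSEQ_le_const2)
  show "(\<lambda>n. norm (crosscut_integral pi n z - crosscut_integral pi m z)) \<longlonglongrightarrow>
          norm (tract_fun z - crosscut_integral pi m z)"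
    by (intro tendsto_intros crosscut_integral_LIMSEQ assms)
  show "\<exists>M. \<forall>n\<ge>M. norm (crosscut_integral pi n z - crosscut_integral pi m z) \<le> 16 * exp (- real m)"
    using crosscut_integral_far[OF clr] assms by blast
qed

text \<open>Clearance keeps the denominator nonzero on the cross-cut for every \<open>z\<close> of
  the disc, so one may differentiate under the integral sign.\<close>

lemma holomorphic_crosscut_integral:
  assumes r: "r < 1" and n: "1 \<le> n"
    and clr: "\<And>z. norm z \<le> r \<Longrightarrow> clear {s. real n \<le> Re s \<and> - 11 \<le> Im s \<and> Im s \<le> -2} z"
  shows "crosscut_integral pi n holomorphic_on ball 0 r"
proof -
  define a b where "a = - 2 * pi - pi" and "b = - 2 * pi + pi"
  have ab: "a < b" by (simp add: a_def b_def)
  have s: "Complex n t \<in> strip" "Complex n t \<noteq> 0" "Complex n t \<notin> \<real>\<^sub>\<le>\<^sub>0"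
     if "t \<in> {a..b}" for t
    using that n two_pi_bounds strip_nonpos[of "Complex n t"]
    by (auto simp: strip_def a_def b_def complex_eq_iff complex_nonpos_Reals_iff)
  have nz: "kern_den z (Complex n t) \<noteq> 0" if "z \<in> ball 0 r" "t \<in> {a..b}" for z :: complex and t
    using that clear_not_image[OF clr[of z]] two_pi_bounds
    by (force simp: kern_den_eq_0_iff a_def b_def)
  have "(\<lambda>z. integral (cbox a b) (\<lambda>t. kern z (Complex n t))) holomorphic_on ball 0 r"
  proof (rule leibniz_rule_holomorphic)
    fix z :: complex and t assume zt: "z \<in> ball 0 r" "t \<in> cbox a b"
    then show "((\<lambda>z. kern z (Complex n t)) has_field_derivative
         dexp (Complex n t) * (- \<i> / Complex n t) * exp (\<i> * Ln (Complex n t)) / kern_den z (Complex n t) ^ 2)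
        (at z within ball 0 r)"
      unfolding kern_def kern_den_def using nz[of z t, unfolded kern_den_def]
      using s(2)[of t] zt by (auto intro!: derivative_eq_intros simp: power2_eq_square mult_ac)
  next
    fix z :: complex assume z: "z \<in> ball 0 r"
    show "(\<lambda>t. kern z (Complex n t)) integrable_on cbox a b"
      unfolding kern_def kern_den_def dexp_def
      using s nz[OF z, unfolded kern_den_def] by (intro integrable_continuous continuous_intros) auto
  next
    show "continuous_on (ball 0 r \<times> cbox a b) (\<lambda>(z :: complex, t). dexp (Complex n t) * (- \<i> / Complex n t) *
            exp (\<i> * Ln (Complex n t)) / kern_den z (Complex n t) ^ 2)"
      unfolding case_prod_unfold kern_den_def dexp_def
      using s nz[unfolded kern_den_def] by (intro continuous_intros) auto
  qed simp
  then have "(\<lambda>z. \<i> * integral {a..b} (\<lambda>t. kern z (Complex n t)) / (2 * pi * \<i>)) holomorphic_on ball 0 r"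
    by (intro holomorphic_intros) auto
  moreover have "crosscut_integral pi n = (\<lambda>z. \<i> * integral {a..b} (\<lambda>t. kern z (Complex n t)) / (2 * pi * \<i>))"
    unfolding crosscut_integral_def fun_eq_iff a_def b_def
    by (subst contour_integral_linepath_same_Re) auto
  ultimately show ?thesis by simp
qed

lemma holomorphic_tract_fun: "tract_fun holomorphic_on ball 0 1"
proof -
  have "tract_fun holomorphic_on ball 0 r" if r: "r < 1" for r
  proof -
    obtain N :: nat where N: "2 \<le> N"
      "\<And>w. norm w \<le> r \<Longrightarrow> clear {s. real N \<le> Re s \<and> - 11 \<le> Im s \<and> Im s \<le> -2} w"
      using clear_far[OF r] by blast
    \<comment> \<open>The shift by \<open>N\<close> discards the cross-cuts whose image may still
      meet the disc of radius \<open>r\<close>.\<close>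
    have ul: "uniform_limit (ball 0 r) (\<lambda>n. crosscut_integral pi (n + N)) tract_fun sequentially"
    proof (rule uniform_limitI)
      fix e :: real assume "e > 0"
      then have "eventually (\<lambda>n. 16 * exp (- real n) < e) sequentially"
        using order_tendstoD(2)[OF exp_minus_tendsto_0[of 16]] by blast
      then have "eventually (\<lambda>n. 16 * exp (- real (n + N)) < e) sequentially"
        by (rule sequentially_offset)
      then show "\<forall>\<^sub>F n in sequentially. \<forall>z\<in>ball 0 r. dist (crosscut_integral pi (n + N) z) (tract_fun z) < e"
      proof eventually_elim
        case (elim n)
        show ?case
        proof
          fix z :: complex assume "z \<in> ball 0 r"
          then show "dist (crosscut_integral pi (n + N) z) (tract_fun z) < e"
            using tract_fun_approx[OF N(2), of z "n + N"] r N(1) elim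
            by (simp add: dist_norm norm_minus_commute)
        qed
      qed
    qed
    show ?thesis
    proof (rule holomorphic_uniform_sequence)
      fix n
      have "clear {s. real (n + N) \<le> Re s \<and> - 11 \<le> Im s \<and> Im s \<le> -2} w" if "norm w \<le> r" for w
        using N(2)[OF that] by (rule clear_subset) auto
      then show "crosscut_integral pi (n + N) holomorphic_on ball 0 r"
        using r N(1) by (intro holomorphic_crosscut_integral) auto
    next
      fix x assume "x \<in> ball (0::complex) r"
      then obtain d where "0 < d" "cball x d \<subseteq> ball 0 r"
        using open_contains_cball_eq[OF open_ball] by blast
      then show "\<exists>d>0. cball x d \<subseteq> ball 0 r \<and>
          uniform_limit (cball x d) (\<lambda>n. crosscut_integral pi (n + N)) tract_fun sequentially"
        using uniform_limit_on_subset[OF ul] by blast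
    qed simp
  qed
  then have "tract_fun field_differentiable at z" if "z \<in> ball 0 1" for z
    using that dense[of "norm z" 1]
    by (metis dist_0_norm holomorphic_on_imp_differentiable_at mem_ball open_ball)
  then show ?thesis
    by (simp add: holomorphic_on_def field_differentiable_at_within)
qed

section \<open>Changing the half-width and comparing the limit with the density\<close>

text \<open>The two cross-cuts differ by two segments of length \<open>c - pi\<close> on which the
  density is at most \<open>exp (- n)\<close>. This freedom allows the contour to be moved away from
  a given \<open>z\<close>.\<close>

lemma crosscut_integral_LIMSEQ':
  assumes c: "pi \<le> c" "c \<le> 4 * pi / 3" and z: "norm z < 1"
  shows "(\<lambda>n. crosscut_integral c n z) \<longlonglongrightarrow> tract_fun z"
proof -
  obtain N :: nat where N: "2 \<le> N"
    "\<And>w. norm w \<le> norm z \<Longrightarrow> clear {s. real N \<le> Re s \<and> - 11 \<le> Im s \<and> Im s \<le> -2} w"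
    using clear_far[OF z] by blast
  define C where "C = 16 * (c - pi)"
  have "norm (crosscut_integral c n z - crosscut_integral pi n z) \<le> C * exp (- real n)" if n: "N \<le> n" for n
  proof -
    define p1 p2 p3 p4 where "p1 = Complex n (- 2 * pi - c)" and "p2 = Complex n (- 2 * pi - pi)"
      and "p3 = Complex n (- 2 * pi + pi)" and "p4 = Complex n (- 2 * pi + c)"
    note p_defs = p1_def p2_def p3_def p4_def
    define I where "I = (\<lambda>p q. contour_integral (linepath p q) (kern z))"
    have seg: "closed_segment p1 p4 = {s. Re s = real n \<and> - 2 * pi - c \<le> Im s \<and> Im s \<le> - 2 * pi + c}"
      "closed_segment p2 p4 = {s. Re s = real n \<and> - 2 * pi - pi \<le> Im s \<and> Im s \<le> - 2 * pi + c}"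
      "closed_segment p1 p2 = {s. Re s = real n \<and> - 2 * pi - c \<le> Im s \<and> Im s \<le> - 2 * pi - pi}"
      "closed_segment p3 p4 = {s. Re s = real n \<and> - 2 * pi + pi \<le> Im s \<and> Im s \<le> - 2 * pi + c}"
      unfolding p_defs using c pi_gt_zero by (intro closed_segment_vertical; linarith)+
    have clr: "clear (closed_segment p1 p4) z"
      by (rule clear_subset[OF N(2)]) (use n c two_pi_bounds in \<open>auto simp: seg\<close>)
    have "closed_segment p1 p4 \<subseteq> strip"
      using n N(1) c two_pi_bounds by (auto simp: seg strip_def)
    then have cont: "continuous_on (closed_segment p1 p4) (kern z)"
      using clr by (intro continuous_on_kern clear_not_image)
    have sub: "closed_segment p1 p2 \<subseteq> closed_segment p1 p4" "closed_segment p3 p4 \<subseteq> closed_segment p1 p4"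
      "closed_segment p2 p4 \<subseteq> closed_segment p1 p4"
      unfolding seg using c pi_gt_zero by auto
    have "I p1 p4 = I p1 p2 + I p2 p4"
      unfolding I_def using c pi_gt_zero
      by (intro contour_integral_split_linepath[OF cont]) (simp add: seg p2_def)
    also have "I p2 p4 = I p2 p3 + I p3 p4"
      unfolding I_def using c pi_gt_zero
      by (intro contour_integral_split_linepath continuous_on_subset[OF cont sub(3)]) (simp add: seg p3_def)
    finally have eq: "crosscut_integral c n z - crosscut_integral pi n z = (I p1 p2 + I p3 p4) / (2 * pi * \<i>)"
      by (simp add: crosscut_integral_def I_def p_defs diff_divide_distrib[symmetric])
    have *: "1 \<le> Re s \<and> Im s \<le> -2 \<and> -12 < Im s \<and> norm (dexp s) \<le> exp (- real n)"
      if "s \<in> closed_segment p1 p2 \<union> closed_segment p3 p4" for s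
    proof -
      have s: "Re s = real n" and y: "pi \<le> \<bar>Im s + 2 * pi\<bar>" "\<bar>Im s + 2 * pi\<bar> \<le> 4 * pi / 3"
        using that c pi_gt_zero by (auto simp: seg)
      have "cos (Im s) = cos (Im s + 2 * pi)" by simp
      also have "\<dots> \<le> - 1 / 2" using y pi_gt_zero by (intro cos_le_minus_half) linarith+
      finally have "norm (dexp s) \<le> exp (- real n)" using norm_dexp_le[of s] s by simp
      moreover have "Im s \<le> -2" "-12 < Im s" using y two_pi_bounds unfolding abs_le_iff by linarith+
      ultimately show ?thesis using s n N(1) by auto
    qed
    have "norm (I p1 p2) \<le> 8 * exp (- real n) * norm (p2 - p1)"
      unfolding I_def by (rule segment_bound) (use * clear_subset[OF clr sub(1)] in auto)
    moreover have "norm (I p3 p4) \<le> 8 * exp (- real n) * norm (p4 - p3)"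
      unfolding I_def by (rule segment_bound) (use * clear_subset[OF clr sub(2)] in auto)
    moreover have "p2 - p1 = of_real (c - pi) * \<i>" "p4 - p3 = of_real (c - pi) * \<i>"
      by (simp_all add: p_defs complex_eq_iff)
    then have "norm (p2 - p1) = c - pi" "norm (p4 - p3) = c - pi"
      using c by (simp_all add: norm_mult del: of_real_diff)
    ultimately have le: "norm (I p1 p2 + I p3 p4) \<le> C * exp (- real n)"
      using norm_triangle_ineq[of "I p1 p2" "I p3 p4"] by (simp add: C_def algebra_simps)
    have "norm (crosscut_integral c n z - crosscut_integral pi n z) = norm (I p1 p2 + I p3 p4) / (2 * pi)"
      unfolding eq by (simp add: norm_divide norm_mult)
    also have "\<dots> \<le> norm (I p1 p2 + I p3 p4) / 1"
      using pi_gt3 by (intro divide_left_mono) auto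
    finally show ?thesis using le by simp
  qed
  then have "(\<lambda>n. crosscut_integral c n z - crosscut_integral pi n z) \<longlonglongrightarrow> 0"
    by (intro Lim_null_comparison[OF _ exp_minus_tendsto_0[of C]])
       (auto simp: eventually_sequentially)
  from tendsto_add[OF this crosscut_integral_LIMSEQ[OF z]] show ?thesis by simp
qed

text \<open>Contains the collar of width 1/2 around the left edge \<open>Re s = 1\<close> of the half-strips used as
  contours; the estimates below hold off its image, where compactness suffices instead.\<close>

definition start_box :: "real \<Rightarrow> complex set" where
  "start_box x = cbox (Complex (1/2) (- 23/2)) (Complex x (- 31/20))"

lemma start_box_strip: "start_box x \<subseteq> strip"
  by (auto simp: start_box_def in_cbox_complex_iff strip_def)

lemma compact_start_box: "compact (start_box x)"
  by (simp add: start_box_def)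

lemma box_pm:
  "s \<in> box (Complex x (a - c)) (Complex y (a + c)) \<longleftrightarrow> x < Re s \<and> Re s < y \<and> \<bar>Im s - a\<bar> < c"
  by (auto simp: in_box_complex_iff abs_less_iff)

text \<open>Rectangles starting at \<open>Re s = 1\<close> are extended to infinity. The left edge
  contributes \<open>16 * exp (exp 1)\<close>, the horizontal sides at most 16, and the pole gives
  the sum.\<close>

lemma tract_fun_estimate:
  assumes c: "pi \<le> c" "c \<le> 4 * pi / 3" and z: "norm z < 1" "z \<notin> spiral_map ` start_box 3"
    and clr: "clear {s. 1 \<le> Re s \<and> \<bar>Im s + 2 * pi\<bar> = c} z"
  shows "norm (tract_fun z - (\<Sum>s\<in>{s. 1 < Re s \<and> \<bar>Im s + 2 * pi\<bar> < c \<and> spiral_map s = z}. dexp s))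
           \<le> 16 * exp (exp 1) + 16"
proof -
  define S where "S = (\<Sum>s\<in>{s. 1 < Re s \<and> \<bar>Im s + 2 * pi\<bar> < c \<and> spiral_map s = z}. dexp s)"
  obtain N :: nat where N: "2 \<le> N"
    "\<And>w. norm w \<le> norm z \<Longrightarrow> clear {s. real N \<le> Re s \<and> - 11 \<le> Im s \<and> Im s \<le> -2} w"
    using clear_far[OF z(1)] by blast
  define L where "L = {s. Re s = 1 \<and> \<bar>Im s + 2 * pi\<bar> \<le> c}"
  have L: "clear L z"
    unfolding clear_def
  proof
    fix s assume "s \<in> L"
    then have s: "Re s = 1" "Im s \<le> -2 * pi + c" "Im s \<ge> - 2 * pi - c"
      by (auto simp: L_def abs_le_iff)
    have "ball s (1/2) \<subseteq> start_box 3"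
    proof
      fix t assume "t \<in> ball s (1/2)"
      from dist_half_bounds[OF this] show "t \<in> start_box 3"
        using s c pi_approx by (auto simp: start_box_def in_cbox_complex_iff)
    qed
    then show "z \<notin> spiral_map ` ball s (1/2)" using z by blast
  qed
  have seg: "closed_segment (Complex 1 (- 2 * pi - c)) (Complex 1 (- 2 * pi + c)) = L"
    using c pi_gt_zero by (subst closed_segment_vertical) (auto simp: L_def abs_le_iff)
  have "norm (contour_integral (linepath (Complex 1 (- 2 * pi - c)) (Complex 1 (- 2 * pi + c))) (kern z))
      \<le> 8 * exp (exp 1) * norm (Complex 1 (- 2 * pi + c) - Complex 1 (- 2 * pi - c))"
  proof (rule segment_bound)
    fix s assume "s \<in> closed_segment (Complex 1 (- 2 * pi - c)) (Complex 1 (- 2 * pi + c))"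
    then have s: "Re s = 1" "Im s \<le> -2 * pi + c" "Im s \<ge> - 2 * pi - c"
      unfolding seg by (auto simp: L_def abs_le_iff)
    have "exp 1 * cos (Im s) \<le> exp 1 * 1" by (intro mult_left_mono) auto
    then have "norm (dexp s) \<le> exp (exp 1)" by (simp add: norm_dexp s)
    then show "1 \<le> Re s \<and> Im s \<le> - 2 \<and> - 12 < Im s \<and> norm (dexp s) \<le> exp (exp 1)"
      using s c two_pi_bounds by auto
  qed (use L seg in simp)
  \<comment> \<open>A length of at most 4 pi, times 8 from the kernel bound and divided by 2 pi,
    gives the factor 16.\<close>
  also have "Complex 1 (- 2 * pi + c) - Complex 1 (- 2 * pi - c) = of_real (2 * c) * \<i>"
    by (simp add: complex_eq_iff)
  also have "norm (of_real (2 * c) * \<i>) \<le> 2 * (2 * pi)"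
    using c pi_gt_zero by (simp add: norm_mult)
  finally have left: "norm (crosscut_integral c 1 z) \<le> 16 * exp (exp 1)"
    by (simp add: crosscut_integral_def norm_divide norm_mult field_simps)
  have "norm (crosscut_integral c n z - S) \<le> 16 * exp (exp 1) + 16" if n: "N \<le> n" for n
  proof -
    define R where "R = {s \<in> box (Complex (real 1) (- 2 * pi - c)) (Complex (real n) (- 2 * pi + c)). spiral_map s = z}"
    have clr': "clear (path_image (rectpath (Complex (real 1) (- 2 * pi - c)) (Complex (real n) (- 2 * pi + c)))) z"
      unfolding clear_def
    proof
      fix s assume "s \<in> path_image (rectpath (Complex (real 1) (- 2 * pi - c)) (Complex (real n) (- 2 * pi + c)))"
      then have "s \<in> L \<or> (1 \<le> Re s \<and> \<bar>Im s + 2 * pi\<bar> = c) \<or>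
          (real N \<le> Re s \<and> - 11 \<le> Im s \<and> Im s \<le> -2)"
        using c n N(1) two_pi_bounds
        by (subst (asm) path_image_rectpath) (auto simp: L_def abs_le_iff)
      then show "z \<notin> spiral_map ` ball s (1/2)"
        using L clr N(2)[OF order_refl] by (auto simp: clear_def)
    qed
    have "norm (crosscut_integral c n z - crosscut_integral c 1 z - (\<Sum>s\<in>R. dexp s)) \<le> 16 * exp (- real 1)"
      unfolding R_def using c n N(1) by (intro crosscut_integral_step clr') auto
    \<comment> \<open>Within half-width \<open>c\<close> no preimage of \<open>z\<close> has real
      part \<open>N\<close> or more, so the finite rectangle already catches every term of the
      sum.\<close>
    moreover have "R = {s. 1 < Re s \<and> \<bar>Im s + 2 * pi\<bar> < c \<and> spiral_map s = z}"
    proof -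
      have "Re s < real n" if s: "1 < Re s" "\<bar>Im s + 2 * pi\<bar> < c" "spiral_map s = z" for s
      proof (rule ccontr)
        assume "\<not> ?thesis"
        then have "s \<in> {s. real N \<le> Re s \<and> - 11 \<le> Im s \<and> Im s \<le> -2}"
          using s(2) c n two_pi_bounds by (auto simp: abs_less_iff)
        then show False
          using clear_not_image[OF N(2)[OF order_refl]] s(3) by blast
      qed
      then show ?thesis unfolding R_def box_pm by auto
    qed
    moreover have "16 * exp (- real 1) \<le> 16" by simp
    ultimately have "norm (crosscut_integral c n z - crosscut_integral c 1 z - S) \<le> 16"
      unfolding S_def by (metis order.trans)
    moreover have "crosscut_integral c n z - S =
        crosscut_integral c 1 z + (crosscut_integral c n z - crosscut_integral c 1 z - S)" by simp
    then have "norm (crosscut_integral c n z - S) \<le>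
        norm (crosscut_integral c 1 z) + norm (crosscut_integral c n z - crosscut_integral c 1 z - S)"
      by (metis norm_triangle_ineq)
    ultimately show ?thesis using left by linarith
  qed
  moreover have "(\<lambda>n. norm (crosscut_integral c n z - S)) \<longlonglongrightarrow> norm (tract_fun z - S)"
    by (intro tendsto_intros crosscut_integral_LIMSEQ' c z(1))
  ultimately show ?thesis
    unfolding S_def[symmetric] by (intro LIMSEQ_le_const2) blast+
qed

text \<open>At the largest half-width the upper edge has height -2 pi / 3, and -2 pi / 3 + 1/2 is
  still below -3/2; the lower side has room similarly.\<close>

lemma strip_neighbourhood:
  assumes "1 \<le> Re s" "\<bar>Im s + 2 * pi\<bar> \<le> 4 * pi / 3" "t \<in> ball s (1/2)"
  shows "t \<in> strip"
proof -
  have "Im s \<le> 4 * pi / 3 - 2 * pi" "- 2 * pi - 4 * pi / 3 \<le> Im s"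
    using assms(2) unfolding abs_le_iff by linarith+
  then show ?thesis
    using dist_half_bounds[OF assms(3)] assms(1) pi_approx by (auto simp: strip_def)
qed

lemma central_strip:
  assumes "0 < Re s" "\<bar>Im s + 2 * pi\<bar> \<le> 2"
  shows "s \<in> strip"
  using assms two_pi_bounds by (auto simp: strip_def abs_le_iff)

text \<open>Points within 2 of the centre line are more than 1/2 away from the edges of half-width
  pi, so the estimate applies with \<open>c = pi\<close>, and injectivity reduces the sum to one
  term.\<close>

lemma tract_fun_central:
  assumes s: "3 < Re s" "\<bar>Im s + 2 * pi\<bar> \<le> 2"
  shows "norm (tract_fun (spiral_map s) - dexp s) \<le> 16 * exp (exp 1) + 16"
proof -
  have strip: "s \<in> strip" using s by (intro central_strip) auto
  have not_box: "spiral_map s \<notin> spiral_map ` start_box 3"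
  proof
    assume "spiral_map s \<in> spiral_map ` start_box 3"
    then have "s \<in> start_box 3"
      using strip start_box_strip[of 3] inj_spiral_map by (auto simp: inj_on_def subset_iff)
    then show False using s by (simp add: start_box_def in_cbox_complex_iff)
  qed
  have clr: "clear {t. 1 \<le> Re t \<and> \<bar>Im t + 2 * pi\<bar> = pi} (spiral_map s)"
    unfolding clear_def
  proof safe
    fix t r assume t: "1 \<le> Re t" "\<bar>Im t + 2 * pi\<bar> = pi" and r: "r \<in> ball t (1/2)"
      and eq: "spiral_map s = spiral_map r"
    have "r \<in> strip" using strip_neighbourhood[OF t(1) _ r] t(2) by simp
    then have "r = s" using eq strip inj_spiral_map by (auto simp: inj_on_def)
    then show False using dist_half_bounds[OF r] t(2) s(2) two_pi_bounds by simp
  qed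
  have "{t. 1 < Re t \<and> \<bar>Im t + 2 * pi\<bar> < pi \<and> spiral_map t = spiral_map s} = {s}"
  proof (intro equalityI subsetI)
    fix t assume "t \<in> {t. 1 < Re t \<and> \<bar>Im t + 2 * pi\<bar> < pi \<and> spiral_map t = spiral_map s}"
    then have t: "1 < Re t" "\<bar>Im t + 2 * pi\<bar> < pi" "spiral_map t = spiral_map s" by auto
    have "\<bar>Im t + 2 * pi\<bar> \<le> 4 * pi / 3" using t(2) pi_gt_zero by linarith
    then have "t \<in> strip" using t(1) by (intro strip_neighbourhood[of t]) auto
    then show "t \<in> {s}" using t(3) strip inj_spiral_map by (auto simp: inj_on_def)
  qed (use s two_pi_bounds in auto)
  moreover have "norm (spiral_map s) < 1" by (rule spiral_map_in_disc[OF strip])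
  ultimately show ?thesis
    using tract_fun_estimate[of pi "spiral_map s", OF _ _ _ not_box clr] by simp
qed

text \<open>The collars of width 1/2 around the strips of half-widths \<open>pi\<close> and \<open>4 * pi / 3\<close> are
  disjoint, so every point avoids one of them.\<close>

lemma tract_fun_large:
  assumes z: "norm z < 1" "z \<notin> spiral_map ` start_box 3"
    and large: "norm (tract_fun z) > 16 * exp (exp 1) + 17"
  obtains s where "1 < Re s" "\<bar>Im s + 2 * pi\<bar> < pi / 2" "spiral_map s = z"
proof -
  have "\<exists>c\<in>{pi, 4 * pi / 3}. clear {s. 1 \<le> Re s \<and> \<bar>Im s + 2 * pi\<bar> = c} z"
  proof (rule ccontr)
    assume no: "\<not> ?thesis"
    from no obtain s1 t1 where 1: "1 \<le> Re s1" "\<bar>Im s1 + 2 * pi\<bar> = pi" "t1 \<in> ball s1 (1/2)" "z = spiral_map t1"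
      by (auto simp: clear_def)
    from no obtain s2 t2 where 2: "1 \<le> Re s2" "\<bar>Im s2 + 2 * pi\<bar> = 4 * pi / 3" "t2 \<in> ball s2 (1/2)" "z = spiral_map t2"
      by (auto simp: clear_def)
    have "t1 \<in> strip" "t2 \<in> strip" using strip_neighbourhood 1 2 by auto
    then have "t1 = t2" using 1(4) 2(4) inj_spiral_map by (auto simp: inj_on_def)
    \<comment> \<open>The radii add up to 1, whereas the half-widths differ by pi / 3, which is
      larger.\<close>
    then have "\<bar>Im s2 - Im s1\<bar> < 1"
      using dist_half_bounds[OF 1(3)] dist_half_bounds[OF 2(3)] unfolding abs_less_iff by simp
    then show False
      using abs_triangle_ineq2[of "Im s2 + 2 * pi" "Im s1 + 2 * pi"] 1(2) 2(2) two_pi_bounds by simp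
  qed
  then obtain c where c: "c \<in> {pi, 4 * pi / 3}" "clear {s. 1 \<le> Re s \<and> \<bar>Im s + 2 * pi\<bar> = c} z"
    by blast
  define P where "P = {s. 1 < Re s \<and> \<bar>Im s + 2 * pi\<bar> < c \<and> spiral_map s = z}"
  have "c = pi \<or> c = 4 * pi / 3" using c(1) by auto
  then have c_bounds: "pi \<le> c" "c \<le> 4 * pi / 3" using pi_gt_zero by linarith+
  have "norm (tract_fun z - (\<Sum>s\<in>P. dexp s)) \<le> 16 * exp (exp 1) + 16"
    unfolding P_def by (intro tract_fun_estimate c_bounds z c(2))
  \<comment> \<open>The constant 17 instead of 16 leaves more than 1 for the sum, so it is not
    empty.\<close>
  then have gt: "norm (\<Sum>s\<in>P. dexp s) > 1"
    using large norm_triangle_ineq2[of "tract_fun z" "\<Sum>s\<in>P. dexp s"] by linarith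
  then obtain s where s: "s \<in> P" by fastforce
  have P_strip: "t \<in> strip" if "t \<in> P" for t
    using that c_bounds by (intro strip_neighbourhood[of t]) (auto simp: P_def)
  have "P = {s}"
    using s P_strip inj_spiral_map by (auto simp: inj_on_def P_def)
  with gt have "norm (dexp s) > 1" by simp
  \<comment> \<open>A density larger than 1 in modulus needs a positive cosine, which excludes
    distances from pi / 2 to 4 pi / 3 from the centre line.\<close>
  then have "cos (Im s) > 0" by (simp add: norm_dexp zero_less_mult_iff)
  then have cos: "cos \<bar>Im s + 2 * pi\<bar> > 0" by simp
  have "\<bar>Im s + 2 * pi\<bar> < pi / 2"
  proof (rule ccontr)
    assume "\<not> ?thesis"
    moreover have "\<bar>Im s + 2 * pi\<bar> < 4 * pi / 3" using s c_bounds(2) by (simp add: P_def)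
    ultimately have "cos (\<bar>Im s + 2 * pi\<bar> - pi) \<ge> 0"
      by (intro cos_ge_zero) auto
    then show False using cos by (simp add: cos_diff)
  qed
  then show ?thesis using s that by (auto simp: P_def)
qed

text \<open>Raising \<open>M\<close> above the maximum over the compact image of
  \<open>start_box 4\<close> pushes the preimages of large values beyond \<open>Re s = 4\<close>.
  They then have a neighbourhood in the region \<open>Re s > 3\<close> of the first
  estimate.\<close>

lemma tract_fun_bounds:
  obtains M where "0 < M"
    "\<And>s. 3 < Re s \<Longrightarrow> \<bar>Im s + 2 * pi\<bar> \<le> 2 \<Longrightarrow> norm (tract_fun (spiral_map s) - dexp s) \<le> M"
    "\<And>z. norm z < 1 \<Longrightarrow> M < norm (tract_fun z) \<Longrightarrow>
       \<exists>s. 4 < Re s \<and> \<bar>Im s + 2 * pi\<bar> < pi / 2 \<and> spiral_map s = z"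
proof -
  have "compact (tract_fun ` spiral_map ` start_box 4)"
  proof (intro compact_continuous_image compact_start_box)
    show "continuous_on (start_box 4) spiral_map"
      using continuous_on_spiral_map start_box_strip continuous_on_subset by blast
    have "spiral_map ` start_box 4 \<subseteq> ball 0 1"
      using spiral_map_in_disc start_box_strip by fastforce
    then show "continuous_on (spiral_map ` start_box 4) tract_fun"
      using holomorphic_on_imp_continuous_on[OF holomorphic_tract_fun] continuous_on_subset by blast
  qed
  then obtain B where B: "\<And>s. s \<in> start_box 4 \<Longrightarrow> norm (tract_fun (spiral_map s)) \<le> B"
    using compact_imp_bounded[of "tract_fun ` spiral_map ` start_box 4"]
    by (auto simp: bounded_iff)
  define M where "M = max B (16 * exp (exp 1) + 17)"
  show ?thesis
  proof (rule that[of M])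
    show "0 < M" using exp_gt_zero[of "exp 1 :: real"] by (simp add: M_def less_max_iff_disj add_pos_pos)
    show "norm (tract_fun (spiral_map s) - dexp s) \<le> M" if "3 < Re s" "\<bar>Im s + 2 * pi\<bar> \<le> 2" for s
      using tract_fun_central[OF that] by (simp add: M_def)
    fix z :: complex assume z: "norm z < 1" and M: "M < norm (tract_fun z)"
    have not_box: "z \<notin> spiral_map ` start_box 4"
      using B M by (fastforce simp: M_def)
    moreover have "start_box 3 \<subseteq> start_box 4"
      by (auto simp: start_box_def in_cbox_complex_iff)
    ultimately have "z \<notin> spiral_map ` start_box 3" by blast
    then obtain s where s: "1 < Re s" "\<bar>Im s + 2 * pi\<bar> < pi / 2" "spiral_map s = z"
      using tract_fun_large[OF z, of thesis] M by (auto simp: M_def)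
    have "s \<notin> start_box 4" using not_box s by blast
    then have "4 < Re s"
      using s two_pi_bounds by (auto simp: start_box_def in_cbox_complex_iff abs_less_iff)
    then show "\<exists>s. 4 < Re s \<and> \<bar>Im s + 2 * pi\<bar> < pi / 2 \<and> spiral_map s = z"
      using s by blast
  qed
qed

subsection \<open>Critical and asymptotic values\<close>

text \<open>At a critical point with large value the error term \<open>h\<close> has derivative
  \<open>- dexp s * exp s\<close>. Cauchy's inequality bounds it, and
  \<open>norm (exp s) >= 1\<close> then bounds \<open>dexp s\<close> and the critical value.\<close>

lemma bounded_critical_values: "bounded (critical_values tract_fun)"
proof -
  obtain M where M: "0 < M"
    "\<And>s. 3 < Re s \<Longrightarrow> \<bar>Im s + 2 * pi\<bar> \<le> 2 \<Longrightarrow> norm (tract_fun (spiral_map s) - dexp s) \<le> M"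
    "\<And>z. norm z < 1 \<Longrightarrow> M < norm (tract_fun z) \<Longrightarrow>
       \<exists>s. 4 < Re s \<and> \<bar>Im s + 2 * pi\<bar> < pi / 2 \<and> spiral_map s = z"
    using tract_fun_bounds by blast
  have "norm (tract_fun z) \<le> M + 4 * (M + 1)" if z: "norm z < 1" and crit: "deriv tract_fun z = 0" for z
  proof (cases "M < norm (tract_fun z)")
    case True
    then obtain s where s: "4 < Re s" "\<bar>Im s + 2 * pi\<bar> < pi / 2" "spiral_map s = z"
      using M(3) z by blast
    define h where "h = (\<lambda>t. tract_fun (spiral_map t) - dexp t)"
    have near: "3 < Re t \<and> \<bar>Im t + 2 * pi\<bar> \<le> 2" if "t \<in> cball s (1/4)" for t
    proof -
      have "\<bar>Re (s - t)\<bar> \<le> 1/4" "\<bar>Im (s - t)\<bar> \<le> 1/4"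
        using that abs_Re_le_cmod[of "s - t"] abs_Im_le_cmod[of "s - t"] by (auto simp: dist_norm)
      then show ?thesis
        using s(1,2) pi_approx unfolding abs_le_iff abs_less_iff by simp
    qed
    have strip: "t \<in> strip" if "t \<in> cball s (1/4)" for t
      using near[OF that] by (intro central_strip) auto
    have holo: "h holomorphic_on strip"
      unfolding h_def dexp_def using spiral_map_in_disc
      by (intro holomorphic_intros holomorphic_on_compose_gen[OF holomorphic_spiral_map holomorphic_tract_fun, unfolded o_def])
         auto
    \<comment> \<open>The radius 1/4 fits since pi / 2 + 1/4 < 2; \<open>M + 1\<close> provides the
      strict bound for the open ball.\<close>
    have "norm ((deriv ^^ 1) h s) \<le> fact 1 * (M + 1) / (1/4) ^ 1"
    proof (rule Cauchy_higher_deriv_bound)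
      show "h holomorphic_on ball s (1/4)"
        using strip by (intro holomorphic_on_subset[OF holo]) auto
      show "continuous_on (cball s (1/4)) h"
        using strip by (intro continuous_on_subset[OF holomorphic_on_imp_continuous_on[OF holo]]) auto
      show "h t \<in> ball 0 (M + 1)" if "t \<in> ball s (1/4)" for t
        using M(2)[of t] near[of t] that by (auto simp: h_def)
    qed auto
    then have dh: "norm (deriv h s) \<le> 4 * (M + 1)" by simp
    have s_strip: "s \<in> strip" by (rule strip) simp
    have "(tract_fun has_field_derivative 0) (at (spiral_map s))"
      using holomorphic_derivI[OF holomorphic_tract_fun, of z] z crit s(3) by simp
    moreover have "(spiral_map has_field_derivative deriv spiral_map s) (at s)"
      by (rule holomorphic_derivI[OF holomorphic_spiral_map open_strip s_strip])
    ultimately have "((\<lambda>t. tract_fun (spiral_map t)) has_field_derivative 0 * deriv spiral_map s) (at s)"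
      by (rule DERIV_chain2)
    then have "(h has_field_derivative 0 * deriv spiral_map s - dexp s * exp s) (at s)"
      unfolding h_def dexp_def by (auto intro!: derivative_eq_intros)
    then have "norm (dexp s) * norm (exp s) \<le> 4 * (M + 1)"
      using dh by (simp add: DERIV_imp_deriv norm_mult)
    moreover have "norm (dexp s) * 1 \<le> norm (dexp s) * norm (exp s)"
      using s(1) by (intro mult_left_mono) auto
    moreover have "norm (tract_fun z) \<le> norm (dexp s) + M"
      using M(2)[of s] near[of s] s(3) norm_triangle_ineq2[of "tract_fun z" "dexp s"] by simp
    ultimately show ?thesis by simp
  qed (use M(1) in simp)
  then show ?thesis
    unfolding bounded_iff critical_values_def by auto
qed

lemma unbounded_tract_fun: "\<not> bounded (tract_fun ` ball 0 1)"
proof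
  obtain M where M: "0 < M"
    "\<And>s. 3 < Re s \<Longrightarrow> \<bar>Im s + 2 * pi\<bar> \<le> 2 \<Longrightarrow> norm (tract_fun (spiral_map s) - dexp s) \<le> M"
    using tract_fun_bounds by metis
  assume "bounded (tract_fun ` ball 0 1)"
  then obtain B where "\<forall>y\<in>tract_fun ` ball 0 1. norm y \<le> B"
    unfolding bounded_iff by blast
  then have B: "norm (tract_fun z) \<le> B" if "norm z < 1" for z
    using that by auto
  \<comment> \<open>On the centre line the cosine is 1, so the density is
    \<open>exp (exp (Re s))\<close>; the real part is chosen to make it exceed
    \<open>B + M\<close>.\<close>
  define s where "s = Complex (max 4 (B + M)) (- 2 * pi)"
  have "s \<in> strip" by (rule central_strip) (auto simp: s_def)
  then have "norm (tract_fun (spiral_map s)) \<le> B" by (intro B spiral_map_in_disc)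
  moreover have "norm (tract_fun (spiral_map s) - dexp s) \<le> M" by (rule M(2)) (auto simp: s_def)
  ultimately have "norm (dexp s) \<le> B + M"
    using norm_triangle_ineq3[of "tract_fun (spiral_map s)" "dexp s"] by simp
  moreover have "norm (dexp s) = exp (exp (Re s))" by (simp add: norm_dexp s_def)
  moreover have "exp (exp (Re s)) \<ge> 1 + (1 + Re s)"
    using exp_ge_add_one_self[of "exp (Re s)"] exp_ge_add_one_self[of "Re s"] by linarith
  ultimately show False by (simp add: s_def)
qed

text \<open>The imaginary part cannot cross the zeros of the cosine, so a path whose exponential stays
  in a disc that omits the origin has bounded imaginary part.\<close>

lemma Im_bounded_of_exp_near:
  fixes u :: "real \<Rightarrow> complex"
  assumes cont: "continuous_on {t0..<t1} u" and a: "0 < norm a"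
    and near: "\<And>t. t \<in> {t0..<t1} \<Longrightarrow> norm (exp (u t) - a) < norm a"
  shows "\<exists>B. \<forall>t\<in>{t0..<t1}. \<bar>Im (u t)\<bar> \<le> B"
proof (cases "t0 < t1")
  case True
  \<comment> \<open>Division by \<open>a\<close> moves the disc to the unit disc about 1, which lies
    in the right half-plane; hence the cosine of \<open>Im u - Im b\<close> is positive.\<close>
  define b where "b = Ln a"
  have b: "exp b = a" using a by (simp add: b_def)
  define v where "v = (\<lambda>t. Im (u t) - Im b)"
  have cont_v: "continuous_on {t0..<t1} v"
    unfolding v_def by (intro continuous_intros cont)
  have cos: "cos (v t) > 0" if "t \<in> {t0..<t1}" for t
  proof -
    have "exp (u t) - a = a * (exp (u t - b) - 1)"
      using b a by (auto simp: exp_diff field_simps)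
    then have "norm a * norm (exp (u t - b) - 1) < norm a * 1"
      using near[OF that] by (simp add: norm_mult)
    then have "norm (exp (u t - b) - 1) < 1" using a by simp
    then have "\<bar>Re (exp (u t - b) - 1)\<bar> < 1"
      using abs_Re_le_cmod order.strict_trans1 by blast
    then have "Re (exp (u t - b)) > 0" by auto
    then show ?thesis by (simp add: Re_exp v_def zero_less_mult_iff)
  qed
  have "\<bar>v t - v t0\<bar> < pi" if t: "t \<in> {t0..<t1}" for t
  proof (rule ccontr)
    assume "\<not> ?thesis"
    then have "v t \<ge> v t0 + pi \<or> v t \<le> v t0 - pi" by auto
    moreover have "continuous_on {t0..t} v"
      using t by (intro continuous_on_subset[OF cont_v]) auto
    ultimately obtain t' where "t0 \<le> t'" "t' \<le> t" "v t' = v t0 + pi \<or> v t' = v t0 - pi"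
      using IVT'[of v t0 "v t0 + pi" t] IVT2'[of v t "v t0 - pi" t0] t by auto
    then show False using cos[of t0] cos[of t'] t by (auto simp: cos_diff cos_add)
  qed
  then have "\<forall>t\<in>{t0..<t1}. \<bar>Im (u t)\<bar> \<le> pi + \<bar>v t0\<bar> + \<bar>Im b\<bar>"
    unfolding v_def by (smt (verit))
  then show ?thesis by blast
qed auto

lemma bounded_asymptotic_values: "bounded (asymptotic_values tract_fun)"
proof -
  obtain M where M: "0 < M"
    "\<And>s. 3 < Re s \<Longrightarrow> \<bar>Im s + 2 * pi\<bar> \<le> 2 \<Longrightarrow> norm (tract_fun (spiral_map s) - dexp s) \<le> M"
    "\<And>z. norm z < 1 \<Longrightarrow> M < norm (tract_fun z) \<Longrightarrow>
       \<exists>s. 4 < Re s \<and> \<bar>Im s + 2 * pi\<bar> < pi / 2 \<and> spiral_map s = z"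
    using tract_fun_bounds by blast
  \<comment> \<open>Holomorphy of the inverse makes the lift of a path to the strip
    continuous.\<close>
  obtain g where g: "g holomorphic_on (spiral_map ` strip)"
    "\<And>s. s \<in> strip \<Longrightarrow> g (spiral_map s) = s"
    using holomorphic_has_inverse[OF holomorphic_spiral_map open_strip inj_spiral_map] by metis
  have "norm a \<le> M + 1" if "a \<in> asymptotic_values tract_fun" for a
  proof (rule ccontr)
    assume large: "\<not> ?thesis"
    obtain \<Gamma> where \<Gamma>: "boundary_path \<Gamma>" and lim: "((\<lambda>t. tract_fun (\<Gamma> t)) \<longlongrightarrow> a) (at_left 1)"
      using \<open>a \<in> asymptotic_values tract_fun\<close> by (auto simp: asymptotic_values_def)
    have cont: "continuous_on {0..<1} \<Gamma>" and disc: "\<And>t. t \<in> {0..<1} \<Longrightarrow> norm (\<Gamma> t) < 1"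
      and to_bd: "((\<lambda>t. norm (\<Gamma> t)) \<longlongrightarrow> 1) (at_left 1)"
      using \<Gamma> by (auto simp: boundary_path_def image_subset_iff)
    \<comment> \<open>Two tolerances are needed: \<open>norm a - M\<close> absorbs the error
      \<open>M\<close> and keeps the density within \<open>norm a\<close> of \<open>a\<close>, while
      1 keeps the function above \<open>M\<close> in modulus.\<close>
    have "eventually (\<lambda>t. dist (tract_fun (\<Gamma> t)) a < norm a - M) (at_left 1)"
      using large by (intro tendstoD[OF lim]) auto
    then have "eventually (\<lambda>t. norm (tract_fun (\<Gamma> t) - a) < norm a - M) (at_left 1)"
      by (simp add: dist_norm)
    moreover have "eventually (\<lambda>t. dist (tract_fun (\<Gamma> t)) a < 1) (at_left 1)"
      by (intro tendstoD[OF lim]) auto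
    ultimately have "eventually (\<lambda>t. norm (tract_fun (\<Gamma> t) - a) < norm a - M \<and>
         norm (tract_fun (\<Gamma> t) - a) < 1) (at_left 1)"
      by eventually_elim (simp add: dist_norm)
    then obtain t0 where t0: "t0 < 1" "\<And>t. t0 < t \<Longrightarrow> t < 1 \<Longrightarrow>
        norm (tract_fun (\<Gamma> t) - a) < norm a - M \<and> norm (tract_fun (\<Gamma> t) - a) < 1"
      unfolding eventually_at_left_field by blast
    define t1 where "t1 = max 0 ((t0 + 1) / 2)"
    have t1: "0 \<le> t1" "t1 < 1" "t0 < t1" using t0(1) by (auto simp: t1_def less_max_iff_disj)
    define w where "w = (\<lambda>t. g (\<Gamma> t))"
    have w: "4 < Re (w t)" "\<bar>Im (w t) + 2 * pi\<bar> < pi / 2" "spiral_map (w t) = \<Gamma> t" "w t \<in> strip"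
      if t: "t \<in> {t1..<1}" for t
    proof -
      have "norm (tract_fun (\<Gamma> t) - a) < 1" using t0(2)[of t] t t1 by auto
      then have "M < norm (tract_fun (\<Gamma> t))"
        using large norm_triangle_ineq3[of "tract_fun (\<Gamma> t)" a] by linarith
      then obtain s where s: "4 < Re s" "\<bar>Im s + 2 * pi\<bar> < pi / 2" "spiral_map s = \<Gamma> t"
        using M(3)[of "\<Gamma> t"] disc[of t] t t1 by auto
      have "s \<in> strip" using s pi_approx by (intro central_strip) auto
      then have "w t = s" using g(2)[of s] s by (simp add: w_def)
      then show "4 < Re (w t)" "\<bar>Im (w t) + 2 * pi\<bar> < pi / 2" "spiral_map (w t) = \<Gamma> t" "w t \<in> strip"
        using s \<open>s \<in> strip\<close> by auto
    qed
    have "\<Gamma> t \<in> spiral_map ` strip" if "t \<in> {t1..<1}" for t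
      using w(3,4)[OF that] by (metis image_eqI)
    then have "continuous_on {t1..<1} w"
      unfolding w_def using t1
      by (intro continuous_on_compose2[OF holomorphic_on_imp_continuous_on[OF g(1)] continuous_on_subset[OF cont]])
         auto
    then have cont_u: "continuous_on {t1..<1} (\<lambda>t. exp (w t))" by (intro continuous_intros)
    have near: "norm (exp (exp (w t)) - a) < norm a" if t: "t \<in> {t1..<1}" for t
    proof -
      have "norm (tract_fun (\<Gamma> t) - dexp (w t)) \<le> M"
        using M(2)[of "w t"] w[OF t] pi_approx by simp
      moreover have "norm (tract_fun (\<Gamma> t) - a) < norm a - M" using t0(2)[of t] t t1 by auto
      moreover have "norm (dexp (w t) - a) \<le> norm (tract_fun (\<Gamma> t) - dexp (w t)) + norm (tract_fun (\<Gamma> t) - a)"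
        by (metis norm_minus_commute norm_diff_triangle_le order_refl)
      ultimately show ?thesis by (simp add: dexp_def)
    qed
    have a: "0 < norm a" using large M(1) by linarith
    obtain B where B: "\<And>t. t \<in> {t1..<1} \<Longrightarrow> \<bar>Im (exp (w t))\<bar> \<le> B"
      using Im_bounded_of_exp_near[OF cont_u a near] by blast
    \<comment> \<open>The lift stays where the cosine is positive, so \<open>Re (exp w)\<close> is
      positive; its exponential is the modulus of the density, hence below
      \<open>2 * norm a\<close>.\<close>
    have Re_bd: "\<bar>Re (exp (w t))\<bar> \<le> 2 * norm a" if t: "t \<in> {t1..<1}" for t
    proof -
      have "cos (Im (w t) + 2 * pi) > 0"
        using w(2)[OF t] unfolding abs_less_iff by (intro cos_gt_zero_pi) linarith+
      then have pos: "Re (exp (w t)) > 0" by (simp add: Re_exp)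
      have "norm (exp (exp (w t))) < 2 * norm a"
        using near[OF t] norm_triangle_ineq2[of "exp (exp (w t))" a] by linarith
      then have "exp (Re (exp (w t))) < 2 * norm a" by simp
      then show ?thesis using pos exp_ge_add_one_self[of "Re (exp (w t))"] by linarith
    qed
    define X where "X = 2 * norm a + B"
    have X: "Re (w t) < X" if t: "t \<in> {t1..<1}" for t
    proof -
      have "exp (Re (w t)) = norm (exp (w t))" by simp
      also have "\<dots> \<le> X"
        using cmod_le[of "exp (w t)"] Re_bd[OF t] B[OF t] by (simp add: X_def)
      finally show ?thesis using exp_ge_add_one_self[of "Re (w t)"] by linarith
    qed
    \<comment> \<open>The tail of the path lies in this compact subset of the open disc, whose
      largest modulus is below 1.\<close>
    define K where "K = spiral_map ` cbox (Complex 4 (- 2 * pi - 2)) (Complex X (- 2 * pi + 2))"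
    have K_strip: "cbox (Complex 4 (- 2 * pi - 2)) (Complex X (- 2 * pi + 2)) \<subseteq> strip"
      using pi_approx by (auto simp: in_cbox_complex_iff strip_def)
    have "compact K"
      unfolding K_def
      by (intro compact_continuous_image compact_cbox continuous_on_subset[OF continuous_on_spiral_map K_strip])
    moreover have \<Gamma>K: "\<Gamma> t \<in> K" if t: "t \<in> {t1..<1}" for t
    proof -
      have "w t \<in> cbox (Complex 4 (- 2 * pi - 2)) (Complex X (- 2 * pi + 2))"
        using w(1,2)[OF t] X[OF t] pi_approx unfolding abs_less_iff by (simp add: in_cbox_complex_iff)
      then show ?thesis using w(3)[OF t] unfolding K_def by (metis image_eqI)
    qed
    then have "K \<noteq> {}" using t1 by fastforce
    ultimately obtain x where x: "x \<in> K" "\<And>y. y \<in> K \<Longrightarrow> norm y \<le> norm x"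
      using continuous_attains_sup[of K norm] by (auto intro: continuous_intros)
    have "norm x < 1" using x(1) K_strip spiral_map_in_disc by (auto simp: K_def)
    have "eventually (\<lambda>t. norm (\<Gamma> t) > norm x) (at_left 1)"
      using order_tendstoD(1)[OF to_bd \<open>norm x < 1\<close>] .
    moreover have "eventually (\<lambda>t. t \<in> {t1<..<1}) (at_left 1)"
      using t1 by (intro eventually_at_leftI) auto
    ultimately have "eventually (\<lambda>t::real. False) (at_left 1)"
    proof eventually_elim
      case (elim t)
      then show False using x(2)[OF \<Gamma>K[of t]] by auto
    qed
    then show False by simp
  qed
  then show ?thesis by (auto simp: bounded_iff)
qed

lemma tract_fun_in_EL_class_disc: "tract_fun \<in> EL_class_disc"
proof -
  have "\<not> tract_fun constant_on ball 0 1"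
    using unbounded_tract_fun unfolding constant_on_def bounded_iff by (metis imageE order_refl)
  then show ?thesis
    using holomorphic_tract_fun bounded_critical_values bounded_asymptotic_values
    by (simp add: EL_class_disc_def)
qed

subsection \<open>The spiral\<close>

text \<open>The summand 1 makes the values start at 2, from where on
  \<open>pi * exp (- u) < 1\<close> lies in the domain of the arcsine.\<close>

definition spiral_arg :: "real \<Rightarrow> real" where
  "spiral_arg t = 1 + 1 / (1 - t)"

text \<open>The image under \<open>spiral_map\<close> of the point with modulus \<open>exp u\<close> on the line \<open>Im s = - pi\<close>, where
  \<open>exp (exp s)\<close> is at most 1 in modulus.\<close>

definition spiral_point :: "real \<Rightarrow> complex" where
  "spiral_point u = of_real (exp (- arcsin (pi * exp (- u)))) * cis (- u)"

lemma pi_exp_le: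
  assumes "2 \<le> u"
  shows "0 < pi * exp (- u)" "pi * exp (- u) < 1"
proof -
  have "(4::real) < 1 + 2 + 2\<^sup>2 / 2" by simp
  also have "\<dots> \<le> exp 2" by (rule exp_lower_Taylor_quadratic) simp
  also have "\<dots> \<le> exp u" using assms by simp
  finally have "pi < exp u" using pi_less_4 by linarith
  then show "0 < pi * exp (- u)" "pi * exp (- u) < 1" by (auto simp: exp_minus field_simps)
qed

text \<open>Take \<open>s = exp (u - i * p)\<close> with \<open>sin p = pi * exp (- u)\<close>. Then
  \<open>Im s = - pi\<close>, and \<open>- i * Ln s = - p - i * u\<close> gives modulus
  \<open>exp (- p)\<close> and argument \<open>- u\<close>.\<close>

lemma spiral_point_eq:
  assumes "2 \<le> u"
  obtains s where "s \<in> strip" "Im s = - pi" "spiral_map s = spiral_point u"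
proof -
  define p where "p = arcsin (pi * exp (- u))"
  have p: "0 < p" "p < pi / 2" "sin p = pi * exp (- u)"
    using pi_exp_le[OF assms] less_trans[of "-1" 0 "pi * exp (- u)"] arcsin_lt_bounded[of "pi * exp (- u)"]
      arcsin_less_arcsin[of 0 "pi * exp (- u)"] unfolding p_def by auto
  define s where "s = exp (Complex u (- p))"
  have Im: "Im s = - pi" using p(3) by (simp add: s_def Im_exp exp_minus field_simps)
  have Re: "Re s > 0" using p by (simp add: s_def Re_exp cos_gt_zero_pi)
  have "Ln s = Complex u (- p)"
    unfolding s_def using p pi_gt_zero by (intro Ln_exp) auto
  then have "spiral_map s = exp (Complex (- p) (- u))"
    by (simp add: spiral_map_def complex_eq_iff Re_exp Im_exp)
  also have "\<dots> = spiral_point u"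
    by (simp add: spiral_point_def exp_eq_polar p_def)
  finally show ?thesis
    using that[of s] Re Im two_pi_bounds by (auto simp: strip_def)
qed

lemma norm_spiral_point: "norm (spiral_point u) = exp (- arcsin (pi * exp (- u)))"
  by (simp add: spiral_point_def norm_mult)

lemma norm_spiral_point_tendsto: "((\<lambda>u. norm (spiral_point u)) \<longlongrightarrow> 1) at_top"
proof -
  have "((\<lambda>u::real. exp (- u)) \<longlongrightarrow> 0) at_top"
    by (rule filterlim_compose[OF exp_at_bot filterlim_uminus_at_bot_at_top])
  then have "((\<lambda>u. pi * exp (- u)) \<longlongrightarrow> 0) at_top"
    by (rule tendsto_mult_right_zero)
  then have "((\<lambda>u. arcsin (pi * exp (- u))) \<longlongrightarrow> arcsin 0) at_top"
    by (intro isCont_tendsto_compose[OF isCont_arcsin]) auto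
  then have "((\<lambda>u. exp (- arcsin (pi * exp (- u)))) \<longlongrightarrow> exp (- 0)) at_top"
    by (intro tendsto_intros) simp
  then show ?thesis by (simp add: norm_spiral_point)
qed

lemma continuous_on_spiral_point: "continuous_on {2..} spiral_point"
  unfolding spiral_point_def
proof (intro continuous_intros)
  show "\<forall>u\<in>{2..}. - 1 \<le> pi * exp (- u) \<and> pi * exp (- u) \<le> 1"
    using pi_exp_le by (auto intro: less_imp_le order.trans[of "-1" 0])
qed

lemma spiral_arg_ge: "t \<in> {0..<1} \<Longrightarrow> 2 \<le> spiral_arg t"
  by (auto simp: spiral_arg_def field_simps)

lemma spiral_arg_at_top: "filterlim spiral_arg at_top (at_left 1)"
proof -
  have "((\<lambda>t::real. 1 - t) \<longlongrightarrow> 1 - 1) (at_left 1)" by (intro tendsto_intros)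
  moreover have "eventually (\<lambda>t::real. 0 < 1 - t) (at_left 1)"
    by (auto simp: eventually_at_left_field intro: exI[of _ 0])
  ultimately have "filterlim (\<lambda>t::real. 1 - t) (at_right 0) (at_left 1)"
    by (simp add: filterlim_at eventually_mono)
  then have "filterlim (\<lambda>t::real. inverse (1 - t)) at_top (at_left 1)"
    by (rule filterlim_compose[OF filterlim_inverse_at_top_right])
  then have "filterlim (\<lambda>t::real. 1 + inverse (1 - t)) at_top (at_left 1)"
    by (intro filterlim_tendsto_add_at_top[OF tendsto_const])
  then show ?thesis by (simp add: spiral_arg_def[abs_def] inverse_eq_divide)
qed

lemma boundary_spiral_spiral_point: "boundary_spiral (\<lambda>t. spiral_point (spiral_arg t))"
proof -
  have "continuous_on {0..<1} spiral_arg"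
    unfolding spiral_arg_def by (intro continuous_intros) auto
  moreover from this have "continuous_on {0..<1} (\<lambda>t. spiral_point (spiral_arg t))"
    by (rule continuous_on_compose2[OF continuous_on_spiral_point]) (use spiral_arg_ge in auto)
  moreover have "norm (spiral_point (spiral_arg t)) < 1" if "t \<in> {0..<1}" for t
    using spiral_point_eq[OF spiral_arg_ge[OF that]] spiral_map_in_disc by metis
  moreover have "((\<lambda>t. norm (spiral_point (spiral_arg t))) \<longlongrightarrow> 1) (at_left 1)"
    by (rule filterlim_compose[OF norm_spiral_point_tendsto spiral_arg_at_top])
  \<comment> \<open>The spiral turns clockwise: its argument is
    \<open>- spiral_arg t\<close>.\<close>
  moreover have "filterlim (\<lambda>t. - spiral_arg t) at_bot (at_left 1)"
    using spiral_arg_at_top by (simp add: filterlim_uminus_at_bot)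
  moreover have "spiral_point u \<noteq> 0 \<and> spiral_point u = of_real (norm (spiral_point u)) * cis (- u)" for u
    by (simp add: norm_spiral_point) (simp add: spiral_point_def)
  ultimately show ?thesis
    unfolding boundary_spiral_def boundary_path_def
    by (intro conjI bexI[of _ 0] exI[of _ "\<lambda>t. - spiral_arg t"]) (auto intro!: continuous_intros)
qed

lemma spiral_point_accumulates:
  "sphere 0 1 \<subseteq> closure ((\<lambda>t. spiral_point (spiral_arg t)) ` {0..<1})"
proof
  fix w :: complex assume "w \<in> sphere 0 1"
  then have w: "w = cis (Arg w)" using cis_Arg[of w] by (force simp: sgn_div_norm)
  \<comment> \<open>At these parameters the spiral crosses the ray through \<open>w\<close>;
    \<open>Suc k\<close> keeps them at least 2.\<close>
  define u where "u = (\<lambda>k. 2 * pi * real (Suc k) - Arg w)"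
  have u: "2 \<le> u k" for k
  proof -
    have "2 * pi * 1 \<le> 2 * pi * real (Suc k)" by (intro mult_left_mono) auto
    then show ?thesis using Arg_le_pi[of w] pi_gt3 unfolding u_def by linarith
  qed
  have "real k \<le> u k" for k
  proof -
    have "1 * real k \<le> 2 * pi * real k" using pi_gt3 by (intro mult_right_mono) auto
    then show ?thesis using Arg_le_pi[of w] pi_gt_zero
      unfolding u_def of_nat_Suc distrib_left by linarith
  qed
  then have u_top: "filterlim u at_top sequentially"
    by (intro filterlim_at_top_mono[OF filterlim_real_sequentially]) auto
  have cis: "cis (- u k) = w" for k
  proof -
    have "cis (- u k) = cis (Arg w) * cis (2 * pi * of_int (- int (Suc k)))"
      by (simp add: u_def cis_mult algebra_simps)
    also have "\<dots> = cis (Arg w)" by (simp only: cis_multiple_2pi Ints_of_int mult_1_right)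
    also have "\<dots> = w" by (rule w[symmetric])
    finally show ?thesis .
  qed
  have "((\<lambda>k. of_real (norm (spiral_point (u k))) * w) \<longlongrightarrow> of_real 1 * w) sequentially"
    by (intro tendsto_intros filterlim_compose[OF norm_spiral_point_tendsto u_top])
  moreover have "of_real (norm (spiral_point (u k))) * w = spiral_point (u k)" for k
    unfolding norm_spiral_point by (simp add: spiral_point_def cis)
  ultimately have "(\<lambda>k. spiral_point (u k)) \<longlonglongrightarrow> w" by simp
  moreover have "spiral_point (u k) \<in> (\<lambda>t. spiral_point (spiral_arg t)) ` {0..<1}" for k
  proof (rule image_eqI)
    \<comment> \<open>The witness is the inverse of \<open>spiral_arg\<close> at
      \<open>u k\<close>.\<close>
    show "spiral_point (u k) = spiral_point (spiral_arg (1 - 1 / (u k - 1)))"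
      using u[of k] by (simp add: spiral_arg_def)
    show "1 - 1 / (u k - 1) \<in> {0..<1}" using u[of k] by (auto simp: field_simps)
  qed
  ultimately show "w \<in> closure ((\<lambda>t. spiral_point (spiral_arg t)) ` {0..<1})"
    unfolding closure_sequential by (intro exI[of _ "\<lambda>k. spiral_point (u k)"]) simp
qed

text \<open>The spiral comes from the line at distance pi from the centre line, whereas values above
  \<open>M\<close> have their preimage within pi / 2 of it; injectivity separates the two.\<close>

lemma bounded_tract_fun_spiral:
  "bounded (tract_fun ` (\<lambda>t. spiral_point (spiral_arg t)) ` {0..<1})"
proof -
  obtain M where M: "\<And>z. norm z < 1 \<Longrightarrow> M < norm (tract_fun z) \<Longrightarrow>
       \<exists>s. 4 < Re s \<and> \<bar>Im s + 2 * pi\<bar> < pi / 2 \<and> spiral_map s = z"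
    using tract_fun_bounds by metis
  have "norm (tract_fun (spiral_point u)) \<le> M" if "2 \<le> u" for u
  proof (rule ccontr)
    assume large: "\<not> ?thesis"
    obtain s where s: "s \<in> strip" "Im s = - pi" "spiral_map s = spiral_point u"
      using spiral_point_eq[OF \<open>2 \<le> u\<close>] by blast
    obtain t where t: "4 < Re t" "\<bar>Im t + 2 * pi\<bar> < pi / 2" "spiral_map t = spiral_point u"
      using M[of "spiral_point u"] large spiral_map_in_disc[OF s(1)] s(3) by auto
    have "t \<in> strip" using t pi_approx by (intro central_strip) auto
    then have "t = s" using s t inj_spiral_map by (auto simp: inj_on_def)
    then show False using s(2) t(2) by simp
  qed
  then show ?thesis using spiral_arg_ge by (auto simp: bounded_iff intro!: exI[of _ M])
qed

theorem theorem7: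
  "\<exists>f \<in> EL_class_disc. \<not> bounded (f ` unit_disc) \<and>
     (\<exists>\<Gamma>. boundary_spiral \<Gamma> \<and>
        closure (\<Gamma> ` {0..<1}) \<inter> frontier unit_disc = frontier unit_disc \<and>
        bounded (f ` \<Gamma> ` {0..<1}))"
proof (intro bexI conjI exI)
  show "tract_fun \<in> EL_class_disc" by (rule tract_fun_in_EL_class_disc)
  show "\<not> bounded (tract_fun ` unit_disc)" by (rule unbounded_tract_fun)
  show "boundary_spiral (\<lambda>t. spiral_point (spiral_arg t))" by (rule boundary_spiral_spiral_point)
  show "closure ((\<lambda>t. spiral_point (spiral_arg t)) ` {0..<1}) \<inter> frontier unit_disc = frontier unit_disc"
    using spiral_point_accumulates by (auto simp: frontier_ball)
  show "bounded (tract_fun ` (\<lambda>t. spiral_point (spiral_arg t)) ` {0..<1})"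
    by (rule bounded_tract_fun_spiral)
qed

end
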